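(* Let $(M_1,g_1)$ and $(M_2,g_2)$ be pseudo-Riemannian manifolds, let $f:M_1\to(0,\infty)$ be smooth, and let $(M,g)=(M_1\times_f M_2,\ g_1\oplus f^2g_2)$. Let $\zeta=\zeta_1+\zeta_2$ with $\zeta_i\in\mathfrak{X}(M_i)$ (lifted to $M$), let $\lambda\in\mathbb{R}$, and suppose that $(M,g,\zeta,\lambda)$ is a Ricci soliton and that $\zeta$ is a concurrent vector field on $M$. If $\zeta_2\neq 0$, then $M$, $M_1$ and $M_2$ are Ricci flat and are gradient Ricci solitons with $\lambda=1$ (that is, each of them is a gradient Ricci soliton with soliton constant $1$).
   Context: A Ricci soliton $(N,h,\xi,\lambda)$ is a pseudo-Riemannian manifold $(N,h)$ with a vector field $\xi$ and a real constant $\lambda$ such that $\frac12\mathcal{L}_\xi h+\mathrm{Ric}=\lambda h$. It is a gradient Ricci soliton if $\xi$ is the gradient of a smooth function on $N$. A vector field $\xi$ on $(N,h)$ is concurrent if $\nabla_X\xi=X$ for every vector field $X$ on $N$, where $\nabla$ is the Levi-Civita connection of $h$. The warped product $M_1\times_f M_2$ is $M_1\times M_2$ with metric $\pi_1^*g_1+(f\circ\pi_1)^2\pi_2^*g_2$; tensor fields on the factors and their lifts are denoted by the same symbol. *)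

theory Defs
  imports "HOL-Analysis.Analysis"
begin

section \<open>Smooth maps between open subsets of Euclidean spaces\<close>

text \<open>Meant for open \<open>S\<close>. In finite dimension, being \<open>C\<^sup>k\<^sup>+\<^sup>1\<close> is the same as being
  differentiable with all directional derivatives \<open>C\<^sup>k\<close>.\<close>

primrec Ck_on :: "nat \<Rightarrow> 'e::euclidean_space set \<Rightarrow> ('e \<Rightarrow> 'b::real_normed_vector) \<Rightarrow> bool" where
  "Ck_on 0 S f \<longleftrightarrow> continuous_on S f"
| "Ck_on (Suc k) S f \<longleftrightarrow>
     (\<forall>x\<in>S. f differentiable (at x)) \<and> (\<forall>v. Ck_on k S (\<lambda>x. frechet_derivative f (at x) v))"

definition smooth_on :: "'e::euclidean_space set \<Rightarrow> ('e \<Rightarrow> 'b::real_normed_vector) \<Rightarrow> bool" where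
  "smooth_on S f \<longleftrightarrow> (\<forall>k. Ck_on k S f)"

section \<open>Manifolds\<close>

text \<open>A manifold is given by an atlas, i.e. a family of charts indexed by the set \<open>charts M\<close>; the
  atlas need not be maximal. Points live in a Hausdorff second countable type \<open>'a\<close>, and the
  manifold is the open set covered by the patches. The model space \<open>'e\<close> is a Euclidean space, so
  the dimension \<open>DIM('e)\<close> is arbitrary but positive.\<close>

record ('i, 'a, 'e) atlas =
  charts :: "'i set"
  patch :: "'i \<Rightarrow> 'a set"
  coord :: "'i \<Rightarrow> 'a \<Rightarrow> 'e"

definition points :: "('i, 'a, 'e) atlas \<Rightarrow> 'a set" where
  "points M = (\<Union>i\<in>charts M. patch M i)"

definition region :: "('i, 'a, 'e) atlas \<Rightarrow> 'i \<Rightarrow> 'e set" where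
  "region M i = coord M i ` patch M i"

definition coord_inv :: "('i, 'a, 'e) atlas \<Rightarrow> 'i \<Rightarrow> 'e \<Rightarrow> 'a" where
  "coord_inv M i = inv_into (patch M i) (coord M i)"

definition transition :: "('i, 'a, 'e) atlas \<Rightarrow> 'i \<Rightarrow> 'i \<Rightarrow> 'e \<Rightarrow> 'e" where
  "transition M i j = coord M j \<circ> coord_inv M i"

definition jacobian :: "('i, 'a, 'e::euclidean_space) atlas \<Rightarrow> 'i \<Rightarrow> 'i \<Rightarrow> 'a \<Rightarrow> 'e \<Rightarrow> 'e" where
  "jacobian M i j p = frechet_derivative (transition M i j) (at (coord M i p))"

definition smooth_manifold ::
    "('i, 'a::{t2_space,second_countable_topology}, 'e::euclidean_space) atlas \<Rightarrow> bool" where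
  "smooth_manifold M \<longleftrightarrow>
     points M \<noteq> {} \<and>
     (\<forall>i\<in>charts M. open (patch M i) \<and> open (region M i) \<and>
        homeomorphism (patch M i) (region M i) (coord M i) (coord_inv M i)) \<and>
     (\<forall>i\<in>charts M. \<forall>j\<in>charts M.
        smooth_on (coord M i ` (patch M i \<inter> patch M j)) (transition M i j))"

definition smooth_function ::
    "('i, 'a, 'e::euclidean_space) atlas \<Rightarrow> ('a \<Rightarrow> real) \<Rightarrow> bool" where
  "smooth_function M F \<longleftrightarrow> (\<forall>i\<in>charts M. smooth_on (region M i) (F \<circ> coord_inv M i))"

text \<open>Tensor fields are families of component functions, one for each chart and defined on the
  coordinate region of that chart, which obey the tensorial transformation law on overlaps.
  Values outside the coordinate regions are irrelevant.\<close>

type_synonym ('i, 'e) vfield = "'i \<Rightarrow> 'e \<Rightarrow> 'e"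
type_synonym ('i, 'e) tensor2 = "'i \<Rightarrow> 'e \<Rightarrow> 'e \<Rightarrow> 'e \<Rightarrow> real"

definition vector_field ::
    "('i, 'a, 'e::euclidean_space) atlas \<Rightarrow> ('i, 'e) vfield \<Rightarrow> bool" where
  "vector_field M X \<longleftrightarrow>
     (\<forall>i\<in>charts M. smooth_on (region M i) (X i)) \<and>
     (\<forall>i\<in>charts M. \<forall>j\<in>charts M. \<forall>p\<in>patch M i \<inter> patch M j.
        X j (coord M j p) = jacobian M i j p (X i (coord M i p)))"

definition neg_index :: "('e::euclidean_space \<Rightarrow> 'e \<Rightarrow> real) \<Rightarrow> nat" where
  "neg_index B = Max {dim W | W. subspace W \<and> (\<forall>w\<in>W. w \<noteq> 0 \<longrightarrow> B w w < 0)}"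

definition scalar_product :: "('e::euclidean_space \<Rightarrow> 'e \<Rightarrow> real) \<Rightarrow> bool" where
  "scalar_product B \<longleftrightarrow>
     bilinear B \<and> (\<forall>u v. B u v = B v u) \<and> (\<forall>u. (\<forall>v. B u v = 0) \<longrightarrow> u = 0)"

definition pseudo_riemannian_manifold ::
    "('i, 'a::{t2_space,second_countable_topology}, 'e::euclidean_space) atlas
      \<Rightarrow> ('i, 'e) tensor2 \<Rightarrow> bool" where
  "pseudo_riemannian_manifold M h \<longleftrightarrow>
     smooth_manifold M \<and>
     (\<forall>i\<in>charts M. \<forall>u v. smooth_on (region M i) (\<lambda>x. h i x u v)) \<and>
     (\<forall>i\<in>charts M. \<forall>j\<in>charts M. \<forall>p\<in>patch M i \<inter> patch M j. \<forall>u v.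
        h i (coord M i p) u v
          = h j (coord M j p) (jacobian M i j p u) (jacobian M i j p v)) \<and>
     (\<forall>i\<in>charts M. \<forall>x\<in>region M i. scalar_product (h i x)) \<and>
     (\<exists>\<nu>. \<forall>i\<in>charts M. \<forall>x\<in>region M i. neg_index (h i x) = \<nu>)"

section \<open>Connection, curvature and Lie derivative in a chart\<close>

text \<open>Throughout this section, \<open>G\<close> is a metric on a coordinate region. A vector \<open>v\<close>, viewed as the
  constant field \<open>\<lambda>_. v\<close>, is a linear combination of coordinate fields.\<close>

definition bracket ::
    "('e::euclidean_space \<Rightarrow> 'e) \<Rightarrow> ('e \<Rightarrow> 'e) \<Rightarrow> 'e \<Rightarrow> 'e" where
  "bracket X Y x = frechet_derivative Y (at x) (X x) - frechet_derivative X (at x) (Y x)"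

text \<open>\<open>\<Gamma> u v\<close> is the value at \<open>x\<close> of the covariant derivative of the constant field \<open>v\<close> along the
  constant field \<open>u\<close>. As constant fields commute, torsion freeness is the symmetry of \<open>\<Gamma>\<close>; the
  last condition is compatibility with the metric.\<close>

definition levi_civita ::
    "('e::euclidean_space \<Rightarrow> 'e \<Rightarrow> 'e \<Rightarrow> real) \<Rightarrow> 'e \<Rightarrow> ('e \<Rightarrow> 'e \<Rightarrow> 'e) \<Rightarrow> bool" where
  "levi_civita G x \<Gamma> \<longleftrightarrow>
     bilinear \<Gamma> \<and> (\<forall>u v. \<Gamma> u v = \<Gamma> v u) \<and>
     (\<forall>u v w. frechet_derivative (\<lambda>z. G z v w) (at x) u = G x (\<Gamma> u v) w + G x v (\<Gamma> u w))"

definition christoffel ::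
    "('e::euclidean_space \<Rightarrow> 'e \<Rightarrow> 'e \<Rightarrow> real) \<Rightarrow> 'e \<Rightarrow> 'e \<Rightarrow> 'e \<Rightarrow> 'e" where
  "christoffel G x = (THE \<Gamma>. levi_civita G x \<Gamma>)"

definition cov ::
    "('e::euclidean_space \<Rightarrow> 'e \<Rightarrow> 'e \<Rightarrow> real) \<Rightarrow> ('e \<Rightarrow> 'e) \<Rightarrow> ('e \<Rightarrow> 'e) \<Rightarrow> 'e \<Rightarrow> 'e" where
  "cov G X Y x = frechet_derivative Y (at x) (X x) + christoffel G x (X x) (Y x)"

definition curvature ::
    "('e::euclidean_space \<Rightarrow> 'e \<Rightarrow> 'e \<Rightarrow> real)
      \<Rightarrow> ('e \<Rightarrow> 'e) \<Rightarrow> ('e \<Rightarrow> 'e) \<Rightarrow> ('e \<Rightarrow> 'e) \<Rightarrow> 'e \<Rightarrow> 'e" where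
  "curvature G X Y Z x =
     cov G X (cov G Y Z) x - cov G Y (cov G X Z) x - cov G (bracket X Y) Z x"

text \<open>The trace of \<open>u \<mapsto> R(u, v) w\<close>; the inner product only extracts coordinates.\<close>

definition ricci ::
    "('e::euclidean_space \<Rightarrow> 'e \<Rightarrow> 'e \<Rightarrow> real) \<Rightarrow> 'e \<Rightarrow> 'e \<Rightarrow> 'e \<Rightarrow> real" where
  "ricci G x v w = (\<Sum>b\<in>Basis. curvature G (\<lambda>_. b) (\<lambda>_. v) (\<lambda>_. w) x \<bullet> b)"

definition lie_metric ::
    "('e::euclidean_space \<Rightarrow> 'e) \<Rightarrow> ('e \<Rightarrow> 'e \<Rightarrow> 'e \<Rightarrow> real) \<Rightarrow> 'e \<Rightarrow> 'e \<Rightarrow> 'e \<Rightarrow> real" where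
  "lie_metric X G x u v =
     frechet_derivative (\<lambda>z. G z u v) (at x) (X x)
       - G x (bracket X (\<lambda>_. u) x) v - G x u (bracket X (\<lambda>_. v) x)"

text \<open>The fundamental lemma: \<^const>\<open>christoffel\<close> is well defined.\<close>

lemma scalar_product_represents:
  fixes B :: "'e::euclidean_space \<Rightarrow> 'e \<Rightarrow> real"
  assumes B: "scalar_product B" and "linear \<phi>"
  shows "\<exists>a. \<forall>w. B a w = \<phi> w"
proof -
  have bil: "bilinear B" using B by (simp add: scalar_product_def)
  define T where "T a = (\<Sum>b\<in>Basis. B a b *\<^sub>R b)" for a
  have Tw: "T a \<bullet> w = B a w" for a w
  proof -
    have lin: "linear (B a)" using bil by (simp add: bilinear_def)
    have "B a w = B a (\<Sum>b\<in>Basis. (w \<bullet> b) *\<^sub>R b)" by (simp add: euclidean_representation)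
    also have "\<dots> = (\<Sum>b\<in>Basis. (w \<bullet> b) * B a b)"
      using lin by (simp add: linear_sum linear_cmul)
    finally show ?thesis by (simp add: T_def inner_sum_left inner_commute[of w] mult.commute)
  qed
  have "linear T"
    by (rule linearI; rule vector_eq_rdot[THEN iffD1])
       (simp_all add: Tw inner_left_distrib bilinear_ladd[OF bil] bilinear_lmul[OF bil])
  moreover have "inj T"
  proof -
    have "a = 0" if "T a = 0" for a
      using that Tw[of a] B by (auto simp: scalar_product_def)
    with \<open>linear T\<close> show ?thesis by (simp add: linear_injective_0)
  qed
  ultimately have "surj T" by (rule linear_inj_imp_surj)
  then obtain a where a: "T a = (\<Sum>b\<in>Basis. \<phi> b *\<^sub>R b)" by (metis surjD)
  have "B a w = \<phi> w" for w
  proof -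
    have "\<phi> w = \<phi> (\<Sum>b\<in>Basis. (w \<bullet> b) *\<^sub>R b)" by (simp add: euclidean_representation)
    also have "\<dots> = (\<Sum>b\<in>Basis. (w \<bullet> b) * \<phi> b)"
      using \<open>linear \<phi>\<close> by (simp add: linear_sum linear_cmul)
    finally show ?thesis
      by (simp add: Tw[symmetric] a inner_sum_left inner_commute[of w] mult.commute)
  qed
  then show ?thesis by blast
qed

lemma levi_civita_ex1:
  fixes G :: "'e::euclidean_space \<Rightarrow> 'e \<Rightarrow> 'e \<Rightarrow> real"
  assumes S: "open S" "x \<in> S"
    and G: "\<And>z. z \<in> S \<Longrightarrow> scalar_product (G z)"
    and diff: "\<And>v w. (\<lambda>z. G z v w) differentiable (at x)"
  shows "\<exists>!\<Gamma>. levi_civita G x \<Gamma>"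
proof -
  define D where "D u v w = frechet_derivative (\<lambda>z. G z v w) (at x) u" for u v w
  have bil: "bilinear (G z)" if "z \<in> S" for z using G[OF that] by (simp add: scalar_product_def)
  note bx = bil[OF S(2)]
  have sx: "G x u v = G x v u" for u v using G[OF S(2)] by (simp add: scalar_product_def)
  have nd: "a = b" if "\<And>w. G x a w = G x b w" for a b
  proof -
    have "G x (a - b) w = 0" for w using that by (simp add: bilinear_lsub[OF bx])
    then have "a - b = 0" using G[OF S(2)] unfolding scalar_product_def by blast
    then show ?thesis by simp
  qed
  have hd: "((\<lambda>z. G z v w) has_derivative (\<lambda>u. D u v w)) (at x)" for v w
    using diff unfolding D_def by (simp add: frechet_derivative_works)
  have eqD: "D u v w = E u"
    if "(f has_derivative E) (at x)" "\<And>z. z \<in> S \<Longrightarrow> G z v w = f z" for E f u v w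
  proof -
    have "((\<lambda>z. G z v w) has_derivative E) (at x)"
      by (rule has_derivative_transform_within_open[OF that(1) S]) (simp add: that(2))
    from has_derivative_unique[OF hd this] show ?thesis by metis
  qed
  have Dsym: "D u v w = D u w v" for u v w
    by (rule eqD[OF hd]) (use G in \<open>auto simp: scalar_product_def\<close>)
  have Dadd: "D u v (w + w') = D u v w + D u v w'" for u v w w'
    by (rule eqD[OF has_derivative_add[OF hd hd]]) (simp add: bilinear_radd[OF bil])
  have Dscale: "D u v (c *\<^sub>R w) = c * D u v w" for u v w c
    by (rule eqD[OF has_derivative_mult_right[OF hd]]) (simp add: bilinear_rmul[OF bil])
  have Dadd': "D u (v + v') w = D u v w + D u v' w" for u v v' w
    using Dadd Dsym by metis
  have Dscale': "D u (c *\<^sub>R v) w = c * D u v w" for u v w c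
    using Dscale Dsym by metis
  have Dlin: "linear (\<lambda>u. D u v w)" for v w
    using hd has_derivative_linear by blast
  note Dlins = Dadd Dscale Dadd' Dscale' linear_add[OF Dlin] linear_cmul[OF Dlin]
  define K where "K u v w = (D u v w + D v u w - D w u v) / 2" for u v w
  have "\<exists>a. \<forall>w. G x a w = K u v w" for u v
    by (rule scalar_product_represents[OF G[OF S(2)]], rule linearI)
       (simp_all add: K_def Dlins field_simps)
  then obtain \<Gamma> where \<Gamma>: "G x (\<Gamma> u v) w = K u v w" for u v w by metis
  have "levi_civita G x \<Gamma>"
  proof -
    have sym: "\<Gamma> u v = \<Gamma> v u" for u v
      by (rule nd) (simp add: \<Gamma> K_def Dsym[of _ u v])
    have "linear (\<Gamma> u)" for u
      by (rule linearI; rule nd)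
         (simp_all add: \<Gamma> K_def bilinear_ladd[OF bx] bilinear_lmul[OF bx] Dlins field_simps)
    then have "bilinear \<Gamma>" unfolding bilinear_def using sym by presburger
    moreover have "D u v w = G x (\<Gamma> u v) w + G x v (\<Gamma> u w)" for u v w
      unfolding sx[of v] by (simp add: \<Gamma> K_def Dsym[of v] Dsym[of w] Dsym[of u w v] field_simps)
    ultimately show ?thesis using sym by (simp add: levi_civita_def D_def)
  qed
  moreover have "\<Gamma>' = \<Gamma>" if "levi_civita G x \<Gamma>'" for \<Gamma>'
  proof (intro ext nd)
    fix u v w
    have s: "\<Gamma>' a b = \<Gamma>' b a" and m: "D a b c = G x (\<Gamma>' a b) c + G x b (\<Gamma>' a c)" for a b c
      using that by (auto simp: levi_civita_def D_def)
    have "2 * K u v w = D u v w + D v u w - D w u v" by (simp add: K_def)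
    also have "\<dots> = 2 * G x (\<Gamma>' u v) w"
      using m[of u v w] m[of v u w] m[of w u v] s[of v u] s[of w u] s[of w v]
        sx[of v "\<Gamma>' u w"] by simp
    finally show "G x (\<Gamma>' u v) w = G x (\<Gamma> u v) w" by (simp add: \<Gamma>)
  qed
  ultimately show ?thesis by blast
qed

section \<open>Concurrent vector fields and Ricci solitons\<close>

definition concurrent ::
    "('i, 'a, 'e::euclidean_space) atlas \<Rightarrow> ('i, 'e) tensor2 \<Rightarrow> ('i, 'e) vfield \<Rightarrow> bool" where
  "concurrent M h \<xi> \<longleftrightarrow>
     vector_field M \<xi> \<and>
     (\<forall>X. vector_field M X \<longrightarrow>
        (\<forall>i\<in>charts M. \<forall>x\<in>region M i. cov (h i) (X i) (\<xi> i) x = X i x))"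

definition ricci_flat ::
    "('i, 'a, 'e::euclidean_space) atlas \<Rightarrow> ('i, 'e) tensor2 \<Rightarrow> bool" where
  "ricci_flat M h \<longleftrightarrow> (\<forall>i\<in>charts M. \<forall>x\<in>region M i. \<forall>u v. ricci (h i) x u v = 0)"

definition is_gradient ::
    "('i, 'a, 'e::euclidean_space) atlas \<Rightarrow> ('i, 'e) tensor2 \<Rightarrow> ('a \<Rightarrow> real)
      \<Rightarrow> ('i, 'e) vfield \<Rightarrow> bool" where
  "is_gradient M h F \<xi> \<longleftrightarrow>
     (\<forall>i\<in>charts M. \<forall>x\<in>region M i. \<forall>v.
        h i x (\<xi> i x) v = frechet_derivative (F \<circ> coord_inv M i) (at x) v)"

definition ricci_soliton ::
    "('i, 'a::{t2_space,second_countable_topology}, 'e::euclidean_space) atlas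
      \<Rightarrow> ('i, 'e) tensor2 \<Rightarrow> ('i, 'e) vfield \<Rightarrow> real \<Rightarrow> bool" where
  "ricci_soliton M h \<xi> c \<longleftrightarrow>
     pseudo_riemannian_manifold M h \<and> vector_field M \<xi> \<and>
     (\<forall>i\<in>charts M. \<forall>x\<in>region M i. \<forall>u v.
        1 / 2 * lie_metric (\<xi> i) (h i) x u v + ricci (h i) x u v = c * h i x u v)"

definition gradient_ricci_soliton ::
    "('i, 'a::{t2_space,second_countable_topology}, 'e::euclidean_space) atlas
      \<Rightarrow> ('i, 'e) tensor2 \<Rightarrow> ('i, 'e) vfield \<Rightarrow> real \<Rightarrow> bool" where
  "gradient_ricci_soliton M h \<xi> c \<longleftrightarrow>
     ricci_soliton M h \<xi> c \<and> (\<exists>F. smooth_function M F \<and> is_gradient M h F \<xi>)"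

section \<open>Warped products\<close>

definition product_atlas ::
    "('i, 'a, 'd) atlas \<Rightarrow> ('j, 'b, 'e) atlas \<Rightarrow> ('i \<times> 'j, 'a \<times> 'b, 'd \<times> 'e) atlas" where
  "product_atlas M\<^sub>1 M\<^sub>2 =
     \<lparr> charts = charts M\<^sub>1 \<times> charts M\<^sub>2,
       patch = (\<lambda>k. patch M\<^sub>1 (fst k) \<times> patch M\<^sub>2 (snd k)),
       coord = (\<lambda>k p. (coord M\<^sub>1 (fst k) (fst p), coord M\<^sub>2 (snd k) (snd p))) \<rparr>"

definition warped_metric ::
    "('i, 'a, 'd) atlas \<Rightarrow> ('a \<Rightarrow> real) \<Rightarrow> ('i, 'd) tensor2 \<Rightarrow> ('j, 'e) tensor2
      \<Rightarrow> ('i \<times> 'j, 'd \<times> 'e) tensor2" where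
  "warped_metric M\<^sub>1 f g\<^sub>1 g\<^sub>2 = (\<lambda>k z u v.
     g\<^sub>1 (fst k) (fst z) (fst u) (fst v)
       + (f (coord_inv M\<^sub>1 (fst k) (fst z)))\<^sup>2 * g\<^sub>2 (snd k) (snd z) (snd u) (snd v))"

definition lift\<^sub>1 :: "('i, 'd) vfield \<Rightarrow> ('i \<times> 'j, 'd \<times> 'e::zero) vfield" where
  "lift\<^sub>1 X = (\<lambda>k z. (X (fst k) (fst z), 0))"

definition lift\<^sub>2 :: "('j, 'e) vfield \<Rightarrow> ('i \<times> 'j, 'd::zero \<times> 'e) vfield" where
  "lift\<^sub>2 Y = (\<lambda>k z. (0, Y (snd k) (snd z)))"

definition vf_add :: "('i, 'e::plus) vfield \<Rightarrow> ('i, 'e) vfield \<Rightarrow> ('i, 'e) vfield" where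
  "vf_add X Y = (\<lambda>i x. X i x + Y i x)"

definition vf_nonzero :: "('i, 'a, 'e::zero) atlas \<Rightarrow> ('i, 'e) vfield \<Rightarrow> bool" where
  "vf_nonzero M X \<longleftrightarrow> (\<exists>i\<in>charts M. \<exists>x\<in>region M i. X i x \<noteq> 0)"

end

theory Submission
  imports Defs
begin

text \<open>Bump functions extend every tangent vector to a global vector field, so in each chart
  \<open>\<nabla>\<^sub>u \<zeta> = u\<close> for all constant \<open>u\<close>. Hence \<open>\<L>\<^sub>\<zeta> g = 2 g\<close>, and \<open>R(u, v) \<zeta> = 0\<close> because second
  derivatives commute. Evaluating the soliton equation on \<open>\<zeta>\<close> gives \<open>\<lambda> = 1\<close>, hence \<open>Ric = 0\<close>. The
  one-form dual to \<open>\<zeta>\<close> is closed; its mixed differential is \<open>d(f\<^sup>2)\<close> wedged with the dual of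
  \<open>\<zeta>\<^sub>2\<close>, so \<open>\<zeta>\<^sub>2 \<noteq> 0\<close> forces \<open>df = 0\<close>. Then connection and Ricci tensor split, both factors inherit
  flatness and concurrence, and half the squared length of a concurrent field is a potential
  for it.\<close>

section \<open>Calculus of smooth maps\<close>

text \<open>The metrics are indefinite, so \<open>\<zeta>\<close> and \<open>\<zeta>\<^sub>2\<close>
  may be null at points where they do not vanish. Both \<open>lam = 1\<close> and
  \<open>df = 0\<close> are therefore obtained by pairing with an auxiliary vector supplied by
  nondegeneracy. The constant 1 is half of the factor 2 in the Lie derivative: with
  \<open>Ric(v, \<zeta>) = 0\<close> the soliton equation reads
  \<open>g(v, \<zeta>) = lam * g(v, \<zeta>)\<close>. The field \<open>\<zeta>\<^sub>2\<close> is
  only known to be nonzero at a single point. That suffices, because closedness of the dual form is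
  used at this one point of \<open>M\<^sub>2\<close> paired with every point of
  \<open>M\<^sub>1\<close>. The analytic obstacle is the connection: \<open>christoffel\<close> is a
  definite description made separately at each point, whereas curvature differentiates it, and
  \<open>frechet_derivative\<close> carries no information where differentiability fails.
  Differentiability has to be recovered from the Koszul equation, whose right side is
  smooth.\<close>

lemma frechet_derivativeI:
  "(f has_derivative f') (at x) \<Longrightarrow> frechet_derivative f (at x) = f'"
  by (metis frechet_derivative_at)

lemma differentiable_has_derivative:
  "f differentiable (at x) \<Longrightarrow> (f has_derivative frechet_derivative f (at x)) (at x)"
  using frechet_derivative_works by blast

lemma differentiable_cong_open:
  assumes "f differentiable (at x)" "open S" "x \<in> S" "\<And>z. z \<in> S \<Longrightarrow> f z = g z"
  shows "g differentiable (at x)"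
  using assms has_derivative_transform_within_open unfolding differentiable_def by blast

lemma Ck_on_cong:
  assumes "open S" "Ck_on k S f" "\<And>x. x \<in> S \<Longrightarrow> f x = g x"
  shows "Ck_on k S g"
  using assms(2,3)
proof (induction k arbitrary: f g)
  case 0
  then show ?case by (metis Ck_on.simps(1) continuous_on_cong)
next
  case (Suc k)
  have "g differentiable (at x)" if "x \<in> S" for x
    using differentiable_cong_open[of f x S g] Suc.prems that \<open>open S\<close> by auto
  moreover have "Ck_on k S (\<lambda>x. frechet_derivative g (at x) v)" for v
  proof (rule Suc.IH)
    show "Ck_on k S (\<lambda>x. frechet_derivative f (at x) v)" using Suc.prems by simp
    show "frechet_derivative f (at x) v = frechet_derivative g (at x) v" if "x \<in> S" for x
      using frechet_derivative_transform_within_open[of f x S g] Suc.prems that \<open>open S\<close> by simp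
  qed
  ultimately show ?case by simp
qed

lemma Ck_on_mono:
  assumes "T \<subseteq> S" "Ck_on k S f"
  shows "Ck_on k T f"
  using assms(2)
proof (induction k arbitrary: f)
  case 0
  then show ?case using assms(1) continuous_on_subset by auto
qed (use assms(1) in auto)

text \<open>Derivatives of products and composites contain the undifferentiated factors, which then
  have to count as C^k and not only as C^(k+1).\<close>

lemma Ck_on_SucD: "Ck_on (Suc k) S f \<Longrightarrow> Ck_on k S f"
proof (induction k arbitrary: f)
  case 0
  then show ?case
    by (auto intro!: continuous_at_imp_continuous_on differentiable_imp_continuous_within)
qed simp

text \<open>Meant for fields that are smooth near different points for different reasons, such as a
  cut-off field inside and outside a patch.\<close>

lemma Ck_on_locally:
  assumes "\<And>x. x \<in> S \<Longrightarrow> \<exists>U. open U \<and> x \<in> U \<and> Ck_on k U f"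
  shows "Ck_on k S f"
  using assms
proof (induction k arbitrary: f)
  case 0
  then show ?case
    by (metis Ck_on.simps(1) continuous_at_imp_continuous_on continuous_on_eq_continuous_at)
next
  case (Suc k)
  show ?case
  proof (simp, intro conjI ballI allI)
    show "f differentiable (at x)" if "x \<in> S" for x using Suc.prems[OF that] by auto
    show "Ck_on k S (\<lambda>x. frechet_derivative f (at x) v)" for v
    proof (rule Suc.IH)
      fix x assume "x \<in> S"
      from Suc.prems[OF this]
      show "\<exists>U. open U \<and> x \<in> U \<and> Ck_on k U (\<lambda>x. frechet_derivative f (at x) v)" by auto
    qed
  qed
qed

lemma Ck_on_const: "Ck_on k S (\<lambda>x. c)"
  by (induction k arbitrary: c) simp_all

lemma Ck_on_ident: "Ck_on k S (\<lambda>x. x)"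
  by (cases k) (simp_all add: Ck_on_const)

lemma Ck_on_bounded_linear:
  assumes "bounded_linear L" "open S" "Ck_on k S f"
  shows "Ck_on k S (\<lambda>x. L (f x))"
  using assms(3)
proof (induction k arbitrary: f)
  case 0
  then show ?case using bounded_linear.continuous_on[OF assms(1)] by simp
next
  case (Suc k)
  have d: "((\<lambda>x. L (f x)) has_derivative (\<lambda>v. L (frechet_derivative f (at x) v))) (at x)"
    if "x \<in> S" for x
    using Suc.prems that
    by (auto intro!: bounded_linear.has_derivative[OF assms(1)] differentiable_has_derivative)
  have "Ck_on k S (\<lambda>x. frechet_derivative (\<lambda>x. L (f x)) (at x) v)" for v
    by (rule Ck_on_cong[OF \<open>open S\<close>, of k "\<lambda>x. L (frechet_derivative f (at x) v)"])
       (use Suc frechet_derivativeI[OF d] in auto)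
  then show ?case using d by (auto simp: differentiable_def)
qed

lemma Ck_on_add:
  assumes "open S" "Ck_on k S f" "Ck_on k S g"
  shows "Ck_on k S (\<lambda>x. f x + g x)"
  using assms(2,3)
proof (induction k arbitrary: f g)
  case 0
  then show ?case by (simp add: continuous_on_add)
next
  case (Suc k)
  have d: "((\<lambda>x. f x + g x) has_derivative
      (\<lambda>v. frechet_derivative f (at x) v + frechet_derivative g (at x) v)) (at x)"
    if "x \<in> S" for x
    using Suc.prems that by (auto intro!: has_derivative_add differentiable_has_derivative)
  have "Ck_on k S (\<lambda>x. frechet_derivative (\<lambda>x. f x + g x) (at x) v)" for v
    by (rule Ck_on_cong[OF \<open>open S\<close>,
          of k "\<lambda>x. frechet_derivative f (at x) v + frechet_derivative g (at x) v"])
       (use Suc frechet_derivativeI[OF d] in auto)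
  then show ?case using d by (auto simp: differentiable_def)
qed

lemma Ck_on_sum:
  assumes "open S" "finite I" "\<And>i. i \<in> I \<Longrightarrow> Ck_on k S (f i)"
  shows "Ck_on k S (\<lambda>x. \<Sum>i\<in>I. f i x)"
  using assms(2,3)
proof (induction I rule: finite_induct)
  case empty
  then show ?case by (simp add: Ck_on_const)
next
  case (insert i I)
  then have "Ck_on k S (\<lambda>x. f i x + (\<Sum>i\<in>I. f i x))"
    by (intro Ck_on_add[OF assms(1)]) auto
  with insert show ?case by simp
qed

lemma Ck_on_scaleR:
  assumes "open S" "Ck_on k S f" "Ck_on k S g"
  shows "Ck_on k S (\<lambda>x. f x *\<^sub>R g x)"
  using assms(2,3)
proof (induction k arbitrary: f g)
  case 0
  then show ?case by (simp add: continuous_on_scaleR)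
next
  case (Suc k)
  have d: "((\<lambda>x. f x *\<^sub>R g x) has_derivative
      (\<lambda>v. f x *\<^sub>R frechet_derivative g (at x) v + frechet_derivative f (at x) v *\<^sub>R g x)) (at x)"
    if "x \<in> S" for x
    using Suc.prems that by (auto intro!: has_derivative_scaleR differentiable_has_derivative)
  have "Ck_on k S (\<lambda>x. frechet_derivative (\<lambda>x. f x *\<^sub>R g x) (at x) v)" for v
  proof (rule Ck_on_cong[OF \<open>open S\<close>])
    show "Ck_on k S (\<lambda>x. f x *\<^sub>R frechet_derivative g (at x) v
        + frechet_derivative f (at x) v *\<^sub>R g x)"
      using Suc.prems Ck_on_SucD[OF Suc.prems(1)] Ck_on_SucD[OF Suc.prems(2)]
      by (intro Ck_on_add[OF \<open>open S\<close>] Suc.IH) auto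
  qed (simp add: frechet_derivativeI[OF d])
  then show ?case using d by (auto simp: differentiable_def)
qed

lemma linear_eq_sum_Basis:
  fixes L :: "'e::euclidean_space \<Rightarrow> 'b::real_vector"
  assumes "linear L"
  shows "L v = (\<Sum>b\<in>Basis. (v \<bullet> b) *\<^sub>R L b)"
  by (metis (no_types, lifting) assms euclidean_representation linear_cmul linear_sum sum.cong)

lemma Ck_on_compose:
  fixes f :: "'d::euclidean_space \<Rightarrow> 'e::euclidean_space"
    and g :: "'e \<Rightarrow> 'b::real_normed_vector"
  assumes "open S" "Ck_on k S f" "Ck_on k T g" "f ` S \<subseteq> T"
  shows "Ck_on k S (\<lambda>x. g (f x))"
  using assms(2,3)
proof (induction k arbitrary: g)
  case 0
  then show ?case using assms(4) by (auto intro: continuous_on_compose2)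
next
  case (Suc k)
  have fT: "f x \<in> T" if "x \<in> S" for x using assms(4) that by auto
  have d: "((\<lambda>x. g (f x)) has_derivative
      (\<lambda>v. frechet_derivative g (at (f x)) (frechet_derivative f (at x) v))) (at x)"
    if "x \<in> S" for x
    using Suc.prems that fT[OF that]
    by (auto intro!: has_derivative_compose[of f _ x UNIV g] differentiable_has_derivative)
  have lin: "linear (frechet_derivative g (at (f x)))" if "x \<in> S" for x
    using Suc.prems(2) fT[OF that] by (auto intro: linear_frechet_derivative)
  have "Ck_on k S (\<lambda>x. frechet_derivative (\<lambda>x. g (f x)) (at x) v)" for v
  proof (rule Ck_on_cong[OF \<open>open S\<close>])
    \<comment> \<open>In the chain rule the direction fed to the derivative of \<open>g\<close>
      moves with \<open>x\<close>, but \<open>Ck_on\<close> controls fixed directions only.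
      Expanding the moving direction along \<open>Basis\<close> leaves products of functions that
      the induction hypothesis covers.\<close>
    show "Ck_on k S (\<lambda>x. \<Sum>b\<in>Basis.
        (frechet_derivative f (at x) v \<bullet> b) *\<^sub>R frechet_derivative g (at (f x)) b)"
    proof (intro Ck_on_sum Ck_on_scaleR \<open>open S\<close> finite_Basis)
      show "Ck_on k S (\<lambda>x. frechet_derivative f (at x) v \<bullet> b)" for b
        using Suc.prems(1) by (intro Ck_on_bounded_linear[OF bounded_linear_inner_left \<open>open S\<close>]) simp
      show "Ck_on k S (\<lambda>x. frechet_derivative g (at (f x)) b)" for b
        by (rule Suc.IH[OF Ck_on_SucD[OF Suc.prems(1)]]) (use Suc.prems(2) in simp)
    qed
  qed (simp add: frechet_derivativeI[OF d] linear_eq_sum_Basis[OF lin, symmetric])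
  then show ?case using d by (auto simp: differentiable_def)
qed

section \<open>The same rules for maps that are C^k for every k\<close>

lemma smooth_on_imp_differentiable: "smooth_on S f \<Longrightarrow> x \<in> S \<Longrightarrow> f differentiable (at x)"
  unfolding smooth_on_def by (metis Ck_on.simps(2))

lemma smooth_on_frechet_derivative: "smooth_on S f \<Longrightarrow> smooth_on S (\<lambda>x. frechet_derivative f (at x) v)"
  unfolding smooth_on_def by (metis Ck_on.simps(2))

lemma smooth_on_imp_continuous_on: "smooth_on S f \<Longrightarrow> continuous_on S f"
  unfolding smooth_on_def by (metis Ck_on.simps(1))

lemma smooth_on_cong: "open S \<Longrightarrow> smooth_on S f \<Longrightarrow> (\<And>x. x \<in> S \<Longrightarrow> f x = g x) \<Longrightarrow> smooth_on S g"
  unfolding smooth_on_def using Ck_on_cong by blast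

lemma smooth_on_mono: "T \<subseteq> S \<Longrightarrow> smooth_on S f \<Longrightarrow> smooth_on T f"
  unfolding smooth_on_def using Ck_on_mono by blast

lemma smooth_on_locally:
  "(\<And>x. x \<in> S \<Longrightarrow> \<exists>U. open U \<and> x \<in> U \<and> smooth_on U f) \<Longrightarrow> smooth_on S f"
  unfolding smooth_on_def using Ck_on_locally by metis

lemma smooth_on_const: "smooth_on S (\<lambda>x. c)"
  by (simp add: smooth_on_def Ck_on_const)

lemma smooth_on_ident: "smooth_on S (\<lambda>x. x)"
  by (simp add: smooth_on_def Ck_on_ident)

lemma smooth_on_bounded_linear:
  "bounded_linear L \<Longrightarrow> open S \<Longrightarrow> smooth_on S f \<Longrightarrow> smooth_on S (\<lambda>x. L (f x))"
  by (simp add: smooth_on_def Ck_on_bounded_linear)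

lemma smooth_on_add:
  "open S \<Longrightarrow> smooth_on S f \<Longrightarrow> smooth_on S g \<Longrightarrow> smooth_on S (\<lambda>x. f x + g x)"
  by (simp add: smooth_on_def Ck_on_add)

lemma smooth_on_sum:
  "open S \<Longrightarrow> finite I \<Longrightarrow> (\<And>i. i \<in> I \<Longrightarrow> smooth_on S (f i)) \<Longrightarrow> smooth_on S (\<lambda>x. \<Sum>i\<in>I. f i x)"
  by (simp add: smooth_on_def Ck_on_sum)

lemma smooth_on_scaleR:
  "open S \<Longrightarrow> smooth_on S f \<Longrightarrow> smooth_on S g \<Longrightarrow> smooth_on S (\<lambda>x. f x *\<^sub>R g x)"
  by (simp add: smooth_on_def Ck_on_scaleR)

lemma smooth_on_mult:
  fixes f g :: "'e::euclidean_space \<Rightarrow> real"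
  shows "open S \<Longrightarrow> smooth_on S f \<Longrightarrow> smooth_on S g \<Longrightarrow> smooth_on S (\<lambda>x. f x * g x)"
  using smooth_on_scaleR[of S f g] by simp

lemma smooth_on_compose:
  fixes f :: "'d::euclidean_space \<Rightarrow> 'e::euclidean_space"
  shows "open S \<Longrightarrow> smooth_on S f \<Longrightarrow> smooth_on T g \<Longrightarrow> f ` S \<subseteq> T \<Longrightarrow> smooth_on S (\<lambda>x. g (f x))"
  by (auto simp: smooth_on_def intro: Ck_on_compose)

subsection \<open>Symmetry of the second derivative\<close>

text \<open>The left hand side is symmetric in \<open>u\<close> and \<open>v\<close>.\<close>

lemma second_difference_mvt:
  fixes \<phi> :: "'e::euclidean_space \<Rightarrow> real"
  assumes S: "smooth_on S \<phi>" and t: "0 < t"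
    and sub: "\<And>s r. 0 \<le> s \<Longrightarrow> s \<le> t \<Longrightarrow> 0 \<le> r \<Longrightarrow> r \<le> t \<Longrightarrow> x + s *\<^sub>R u + r *\<^sub>R v \<in> S"
  shows "\<exists>s r. 0 < s \<and> s < t \<and> 0 < r \<and> r < t \<and>
    \<phi> (x + t *\<^sub>R u + t *\<^sub>R v) - \<phi> (x + t *\<^sub>R u) - \<phi> (x + t *\<^sub>R v) + \<phi> x
      = t\<^sup>2 * frechet_derivative (\<lambda>z. frechet_derivative \<phi> (at z) u) (at (x + s *\<^sub>R u + r *\<^sub>R v)) v"
proof -
  define D where "D z = frechet_derivative \<phi> (at z) u" for z
  define D' where "D' z = frechet_derivative D (at z) v" for z
  have line: "((\<lambda>s. \<psi> (a + s *\<^sub>R w)) has_real_derivative frechet_derivative \<psi> (at (a + s *\<^sub>R w)) w) (at s)"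
    if "smooth_on S \<psi>" "a + s *\<^sub>R w \<in> S" for \<psi> :: "'e \<Rightarrow> real" and a w s
  proof -
    note d = differentiable_has_derivative[OF smooth_on_imp_differentiable[OF that]]
    have "((\<lambda>s. a + s *\<^sub>R w) has_derivative (\<lambda>s. s *\<^sub>R w)) (at s)"
      by (auto intro!: derivative_eq_intros)
    from has_derivative_compose[OF this d]
    have "((\<lambda>s. \<psi> (a + s *\<^sub>R w)) has_derivative
        (\<lambda>r. frechet_derivative \<psi> (at (a + s *\<^sub>R w)) (r *\<^sub>R w))) (at s)" .
    then show ?thesis
      using has_derivative_linear[OF d]
      by (simp add: has_field_derivative_def linear_cmul mult.commute[of _ "frechet_derivative _ _ _"])
  qed
  \<comment> \<open>The increment in direction \<open>v\<close>, followed along \<open>u\<close>.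
    The mean value theorem for it leaves an increment of \<open>D\<close> in direction
    \<open>v\<close>, to which the theorem applies once more.\<close>
  define F where "F s = \<phi> (x + t *\<^sub>R v + s *\<^sub>R u) - \<phi> (x + s *\<^sub>R u)" for s
  have "(F has_real_derivative (D (x + t *\<^sub>R v + s *\<^sub>R u) - D (x + s *\<^sub>R u))) (at s)"
    if "0 \<le> s" "s \<le> t" for s
    unfolding F_def D_def
    using sub[of s t] sub[of s 0] that t
    by (intro DERIV_diff line S) (simp_all add: add_ac)
  from MVT2[OF t this] obtain s where s: "0 < s" "s < t"
    "F t - F 0 = t * (D (x + t *\<^sub>R v + s *\<^sub>R u) - D (x + s *\<^sub>R u))" by auto
  have smD: "smooth_on S D" unfolding D_def by (rule smooth_on_frechet_derivative[OF S])
  have "((\<lambda>r. D (x + s *\<^sub>R u + r *\<^sub>R v)) has_real_derivative D' (x + s *\<^sub>R u + r *\<^sub>R v)) (at r)"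
    if "0 \<le> r" "r \<le> t" for r
    unfolding D'_def using sub[of s r] that s by (intro line smD) auto
  from MVT2[OF t this] obtain r where r: "0 < r" "r < t"
    "D (x + s *\<^sub>R u + t *\<^sub>R v) - D (x + s *\<^sub>R u) = t * D' (x + s *\<^sub>R u + r *\<^sub>R v)" by auto
  have "F t - F 0 = t * (t * D' (x + s *\<^sub>R u + r *\<^sub>R v))"
    using s(3) r(3) by (simp add: add_ac)
  moreover have "F t - F 0 = \<phi> (x + t *\<^sub>R u + t *\<^sub>R v) - \<phi> (x + t *\<^sub>R u)
      - \<phi> (x + t *\<^sub>R v) + \<phi> x"
    by (simp add: F_def add_ac)
  ultimately show ?thesis using s(1,2) r(1,2) unfolding D'_def D_def power2_eq_square
    by (intro exI conjI) (assumption | simp)+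
qed

text \<open>The second difference over a small parallelogram, divided by \<open>t\<^sup>2\<close>,
  is a value of either mixed derivative somewhere in that parallelogram. Both mixed derivatives are
  continuous at \<open>x\<close>, so they differ there by less than any \<epsilon>.\<close>

lemma second_derivative_commute_real:
  fixes \<phi> :: "'e::euclidean_space \<Rightarrow> real"
  assumes S: "open S" "x \<in> S" and sm: "smooth_on S \<phi>"
  shows "frechet_derivative (\<lambda>z. frechet_derivative \<phi> (at z) u) (at x) v
       = frechet_derivative (\<lambda>z. frechet_derivative \<phi> (at z) v) (at x) u"
proof -
  define A where "A u v z = frechet_derivative (\<lambda>z. frechet_derivative \<phi> (at z) u) (at z) v" for u v z
  have cont: "isCont (A u v) x" for u v
    using smooth_on_imp_continuous_on[OF smooth_on_frechet_derivative[OF smooth_on_frechet_derivative[OF sm]]]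
      S continuous_on_eq_continuous_at unfolding A_def by blast
  obtain e where e: "e > 0" "ball x e \<subseteq> S" using S open_contains_ball by blast
  have "\<bar>A u v x - A v u x\<bar> < \<epsilon>" if "\<epsilon> > 0" for \<epsilon>
  proof -
    obtain d1 where d1: "d1 > 0" "\<And>y. dist y x < d1 \<Longrightarrow> \<bar>A u v y - A u v x\<bar> < \<epsilon>/2"
      using cont[of u v] \<open>\<epsilon> > 0\<close> unfolding continuous_at_eps_delta dist_real_def by (meson half_gt_zero)
    obtain d2 where d2: "d2 > 0" "\<And>y. dist y x < d2 \<Longrightarrow> \<bar>A v u y - A v u x\<bar> < \<epsilon>/2"
      using cont[of v u] \<open>\<epsilon> > 0\<close> unfolding continuous_at_eps_delta dist_real_def by (meson half_gt_zero)
    define d where "d = min e (min d1 d2)"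
    \<comment> \<open>Scaled so that the whole parallelogram stays within \<open>d\<close> of
      \<open>x\<close>; the summand 1 covers the case \<open>u = v = 0\<close>.\<close>
    define t where "t = d / (norm u + norm v + 1)"
    have "d > 0" using e d1 d2 by (simp add: d_def)
    have N: "norm u + norm v + 1 > 0" by (smt (verit) norm_ge_zero)
    then have t: "t > 0" using \<open>d > 0\<close> by (simp add: t_def)
    have near: "dist (x + s *\<^sub>R a + r *\<^sub>R b) x < d"
      if "0 \<le> s" "s \<le> t" "0 \<le> r" "r \<le> t" "norm a + norm b = norm u + norm v" for s r a b
    proof -
      have "dist (x + s *\<^sub>R a + r *\<^sub>R b) x \<le> s * norm a + r * norm b"
        using that norm_triangle_ineq[of "s *\<^sub>R a" "r *\<^sub>R b"] by (simp add: dist_norm)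
      also have "\<dots> \<le> t * norm a + t * norm b"
        using that by (intro add_mono mult_right_mono) auto
      also have "\<dots> = t * (norm u + norm v)" using that(5) by (metis distrib_left)
      also have "\<dots> < t * (norm u + norm v + 1)" using t by simp
      also have "\<dots> = d" using N by (simp add: t_def)
      finally show ?thesis .
    qed
    have inS: "y \<in> S" if "dist y x < d" for y
      using that e by (auto simp: d_def dist_commute)
    obtain s r where 1: "0 < s" "s < t" "0 < r" "r < t"
      "\<phi> (x + t *\<^sub>R u + t *\<^sub>R v) - \<phi> (x + t *\<^sub>R u) - \<phi> (x + t *\<^sub>R v) + \<phi> x
        = t\<^sup>2 * A u v (x + s *\<^sub>R u + r *\<^sub>R v)"
      using second_difference_mvt[OF sm t, of x u v] near inS unfolding A_def by blast
    obtain s' r' where 2: "0 < s'" "s' < t" "0 < r'" "r' < t"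
      "\<phi> (x + t *\<^sub>R v + t *\<^sub>R u) - \<phi> (x + t *\<^sub>R v) - \<phi> (x + t *\<^sub>R u) + \<phi> x
        = t\<^sup>2 * A v u (x + s' *\<^sub>R v + r' *\<^sub>R u)"
      using second_difference_mvt[OF sm t, of x v u] near[of _ _ v u] inS unfolding A_def
      by (smt (verit, best) add.commute)
    have swap: "x + t *\<^sub>R v + t *\<^sub>R u = x + t *\<^sub>R u + t *\<^sub>R v" by (simp add: add_ac)
    have "t\<^sup>2 * A u v (x + s *\<^sub>R u + r *\<^sub>R v) = t\<^sup>2 * A v u (x + s' *\<^sub>R v + r' *\<^sub>R u)"
      using 1(5) 2(5)[unfolded swap] by linarith
    then have "A u v (x + s *\<^sub>R u + r *\<^sub>R v) = A v u (x + s' *\<^sub>R v + r' *\<^sub>R u)"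
      using t by simp
    moreover have "\<bar>A u v (x + s *\<^sub>R u + r *\<^sub>R v) - A u v x\<bar> < \<epsilon>/2"
      using near[of s r u v] 1 by (intro d1(2)) (auto simp: d_def)
    moreover have "\<bar>A v u (x + s' *\<^sub>R v + r' *\<^sub>R u) - A v u x\<bar> < \<epsilon>/2"
      using near[of s' r' v u] 2 by (intro d2(2)) (auto simp: d_def)
    ultimately show ?thesis by linarith
  qed
  then have "A u v x = A v u x" by (metis abs_0_eq eq_iff_diff_eq_0 less_irrefl zero_less_abs_iff)
  then show ?thesis by (simp add: A_def)
qed

text \<open>The mean value argument needs real values, so it is applied to each component
  \<open>Z y \<bullet> b\<close>.\<close>

lemma second_derivative_commute:
  fixes Z :: "'e::euclidean_space \<Rightarrow> 'b::euclidean_space"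
  assumes S: "open S" "x \<in> S" and sm: "smooth_on S Z"
  shows "frechet_derivative (\<lambda>z. frechet_derivative Z (at z) u) (at x) v
       = frechet_derivative (\<lambda>z. frechet_derivative Z (at z) v) (at x) u"
proof -
  have comp: "frechet_derivative (\<lambda>z. frechet_derivative (\<lambda>y. Z y \<bullet> b) (at z) u) (at x) v
      = frechet_derivative (\<lambda>z. frechet_derivative Z (at z) u) (at x) v \<bullet> b" for b u v
  proof -
    have 1: "frechet_derivative (\<lambda>y. Y y \<bullet> b) (at z) w = frechet_derivative Y (at z) w \<bullet> b"
      if "smooth_on S Y" "z \<in> S" for Y :: "'e \<Rightarrow> 'b" and z w
      by (subst frechet_derivativeI[OF bounded_linear.has_derivative[OF bounded_linear_inner_left
              differentiable_has_derivative[OF smooth_on_imp_differentiable[OF that]]]]) simp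
    have smD: "smooth_on S (\<lambda>z. frechet_derivative Z (at z) u)"
      by (rule smooth_on_frechet_derivative[OF sm])
    have "(\<lambda>z. frechet_derivative Z (at z) u \<bullet> b) differentiable (at x)"
      using smooth_on_imp_differentiable[OF smooth_on_bounded_linear[OF bounded_linear_inner_left S(1) smD] S(2)] .
    from frechet_derivative_transform_within_open[OF this S, of "\<lambda>z. frechet_derivative (\<lambda>y. Z y \<bullet> b) (at z) u"]
    show ?thesis using 1[OF sm] 1[OF smD S(2)] by metis
  qed
  show ?thesis
    by (rule euclidean_eqI)
       (metis comp second_derivative_commute_real[OF S
            smooth_on_bounded_linear[OF bounded_linear_inner_left S(1) sm]])
qed

subsection \<open>A smooth bump function\<close>

text \<open>The functions \<open>t \<mapsto> exp (-1/t) / t ^ n\<close>, extended by zero, are closed under differentiation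
  up to linear combinations.\<close>

definition flat_exp :: "nat \<Rightarrow> real \<Rightarrow> real" where
  "flat_exp n t = (if t > 0 then exp (- (1 / t)) / t ^ n else 0)"

text \<open>With \<open>s = 1/t\<close> this is the fact that \<open>exp s\<close> outgrows every
  power of \<open>s\<close> at infinity.\<close>

lemma flat_exp_tendsto_0: "(flat_exp n \<longlongrightarrow> 0) (at_right 0)"
proof -
  have "((\<lambda>s::real. s ^ n / exp s) \<longlongrightarrow> 0) at_top" by (rule tendsto_power_div_exp_0)
  then have "((\<lambda>t::real. (inverse t) ^ n / exp (inverse t)) \<longlongrightarrow> 0) (at_right 0)"
    by (rule filterlim_compose[OF _ filterlim_inverse_at_top_right])
  then show ?thesis
    by (rule Lim_transform_eventually)
       (auto simp: eventually_at_filter flat_exp_def exp_minus field_simps)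
qed

lemma flat_exp_has_derivative:
  "(flat_exp n has_real_derivative (flat_exp (n + 2) t - real n * flat_exp (n + 1) t)) (at t)"
proof (cases t "0::real" rule: linorder_cases)
  case less
  have "((\<lambda>_. 0) has_real_derivative 0) (at t)" by simp
  then have "(flat_exp n has_real_derivative 0) (at t)"
    by (rule has_field_derivative_transform_within_open[of _ _ _ "{..<0}"])
       (use less in \<open>auto simp: flat_exp_def\<close>)
  then show ?thesis using less by (simp add: flat_exp_def)
next
  case greater
  have "((\<lambda>t. exp (- (1 / t)) / t ^ n) has_real_derivative
      (flat_exp (n + 2) t - real n * flat_exp (n + 1) t)) (at t)"
  proof (rule DERIV_cong)
    show "((\<lambda>t. exp (- (1 / t)) / t ^ n) has_real_derivative
        (exp (- (1 / t)) / t\<^sup>2 * t ^ n - exp (- (1 / t)) * (real n * t ^ (n - 1))) / (t ^ n * t ^ n)) (at t)"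
      using greater by (auto intro!: derivative_eq_intros simp: power2_eq_square)
    have "real n * t ^ (n - 1) = real n * t ^ n / t" using greater by (cases n) auto
    then show "(exp (- (1 / t)) / t\<^sup>2 * t ^ n - exp (- (1 / t)) * (real n * t ^ (n - 1))) / (t ^ n * t ^ n)
        = flat_exp (n + 2) t - real n * flat_exp (n + 1) t"
      using greater by (simp only:) (simp add: flat_exp_def field_simps power2_eq_square)
  qed
  then show ?thesis
    by (rule has_field_derivative_transform_within_open[of _ _ _ "{0<..}"])
       (use greater in \<open>auto simp: flat_exp_def\<close>)
next
  case equal
  \<comment> \<open>Dividing by \<open>h > 0\<close> raises the index by one, so the right
    difference quotient at 0 is again a member of the family, with limit 0.\<close>
  have "((\<lambda>h. flat_exp n h / h) \<longlongrightarrow> 0) (at_right 0)"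
    by (rule Lim_transform_eventually[OF flat_exp_tendsto_0[of "Suc n"]])
       (auto simp: eventually_at_filter flat_exp_def)
  moreover have "((\<lambda>h. flat_exp n h / h) \<longlongrightarrow> 0) (at_left 0)"
    by (rule Lim_transform_eventually[OF tendsto_const])
       (auto simp: eventually_at_filter flat_exp_def)
  ultimately have "((\<lambda>h. flat_exp n h / h) \<longlongrightarrow> 0) (at 0)"
    by (simp add: filterlim_split_at)
  then show ?thesis using equal
    by (simp add: DERIV_def flat_exp_def)
qed

lemma smooth_on_flat_exp: "smooth_on UNIV (flat_exp n)"
proof -
  have D: "frechet_derivative (flat_exp n) (at t) v
      = v *\<^sub>R flat_exp (n + 2) t + (- real n * v) *\<^sub>R flat_exp (n + 1) t" for n t v
    by (subst frechet_derivativeI[OF flat_exp_has_derivative[unfolded has_field_derivative_def]])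
       (simp add: algebra_simps)
  have diff: "flat_exp n differentiable (at t)" for n t
    using flat_exp_has_derivative has_field_derivative_def differentiable_def by blast
  have "Ck_on k UNIV (flat_exp n)" for k
  proof (induction k arbitrary: n)
    case 0
    then show ?case
      by (simp add: diff differentiable_imp_continuous_within continuous_at_imp_continuous_on)
  next
    case (Suc k)
    then show ?case
      unfolding Ck_on.simps D using diff
      by (intro conjI ballI allI Ck_on_add Ck_on_scaleR Ck_on_const) auto
  qed
  then show ?thesis by (simp add: smooth_on_def)
qed

lemma smooth_bump_exists:
  fixes x :: "'e::euclidean_space"
  assumes "r > 0"
  shows "\<exists>\<phi>::'e \<Rightarrow> real. smooth_on UNIV \<phi> \<and> \<phi> x = 1 \<and> (\<forall>z. z \<notin> ball x r \<longrightarrow> \<phi> z = 0)"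
proof -
  \<comment> \<open>The polynomial \<open>r\<^sup>2 - (dist x z)\<^sup>2\<close>, positive exactly
    on the ball and written with sums and products so that the smoothness rules apply. Composing
    with \<open>flat_exp 0\<close> cuts it off smoothly at the sphere; dividing by the value at the
    centre normalises it.\<close>
  define q where "q z = r\<^sup>2 + (-1) * (\<Sum>b\<in>Basis. ((z + (-x)) \<bullet> b) * ((z + (-x)) \<bullet> b))" for z
  have q: "q z = r\<^sup>2 - (dist x z)\<^sup>2" for z
    unfolding q_def dist_norm power2_norm_eq_inner
    by (subst euclidean_inner) (simp add: norm_minus_commute inner_diff_left power2_eq_square[symmetric] power2_commute)
  have "smooth_on UNIV (\<lambda>z. (z + (-x)) \<bullet> b)" for b
    by (intro smooth_on_bounded_linear[OF bounded_linear_inner_left] smooth_on_add smooth_on_ident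
        smooth_on_const) auto
  then have "smooth_on UNIV q"
    unfolding q_def
    by (intro smooth_on_add smooth_on_mult smooth_on_sum smooth_on_const) auto
  then have "smooth_on UNIV (\<lambda>z. flat_exp 0 (q z))"
    by (rule smooth_on_compose[OF open_UNIV _ smooth_on_flat_exp]) simp
  then have "smooth_on UNIV (\<lambda>z. (1 / flat_exp 0 (r\<^sup>2)) * flat_exp 0 (q z))"
    by (rule smooth_on_mult[OF open_UNIV smooth_on_const])
  moreover have "flat_exp 0 (q z) = 0" if "z \<notin> ball x r" for z
    using that assms power_mono[of r "dist x z" 2] by (simp add: q flat_exp_def not_less)
  moreover have "flat_exp 0 (r\<^sup>2) \<noteq> 0" using assms by (simp add: flat_exp_def)
  ultimately show ?thesis
    by (intro exI[of _ "\<lambda>z. (1 / flat_exp 0 (r\<^sup>2)) * flat_exp 0 (q z)"]) (simp add: q)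
qed

section \<open>Extending tangent vectors to vector fields\<close>

locale smooth_atlas =
  fixes M :: "('i, 'a::{t2_space,second_countable_topology}, 'e::euclidean_space) atlas"
  assumes smooth: "smooth_manifold M"
begin

lemma
  assumes "i \<in> charts M"
  shows open_patch: "open (patch M i)" and open_region: "open (region M i)"
    and continuous_coord_inv: "continuous_on (region M i) (coord_inv M i)"
    and coord_inv_coord: "p \<in> patch M i \<Longrightarrow> coord_inv M i (coord M i p) = p"
    and coord_coord_inv: "x \<in> region M i \<Longrightarrow> coord M i (coord_inv M i x) = x"
    and coord_inv_in: "x \<in> region M i \<Longrightarrow> coord_inv M i x \<in> patch M i"
    and coord_in: "p \<in> patch M i \<Longrightarrow> coord M i p \<in> region M i"
  using smooth assms unfolding smooth_manifold_def homeomorphism_def by blast+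

lemma open_coord_inv_preimage:
  assumes "i \<in> charts M" "open V"
  shows "open {x \<in> region M i. coord_inv M i x \<in> V}"
  using continuous_open_preimage[OF continuous_coord_inv[OF assms(1)] open_region[OF assms(1)] assms(2)]
  by (simp add: vimage_def Int_def)

text \<open>Written as a preimage under \<open>coord_inv\<close>, the coordinate image of an overlap
  is open by continuity.\<close>

lemma overlap_eq:
  assumes "i \<in> charts M"
  shows "coord M i ` (patch M i \<inter> V) = {x \<in> region M i. coord_inv M i x \<in> V}"
  using coord_inv_coord[OF assms] coord_coord_inv[OF assms] coord_in[OF assms] coord_inv_in[OF assms]
  by (force simp: image_iff)

lemma open_overlap:
  assumes "i \<in> charts M" "j \<in> charts M"
  shows "open (coord M i ` (patch M i \<inter> patch M j))"
  unfolding overlap_eq[OF assms(1)] using open_coord_inv_preimage assms open_patch by blast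

lemma smooth_transition:
  assumes "i \<in> charts M" "j \<in> charts M"
  shows "smooth_on (coord M i ` (patch M i \<inter> patch M j)) (transition M i j)"
  using smooth assms unfolding smooth_manifold_def by blast

lemma transition_coord:
  "i \<in> charts M \<Longrightarrow> p \<in> patch M i \<Longrightarrow> transition M i j (coord M i p) = coord M j p"
  by (simp add: transition_def coord_inv_coord)

lemma transition_has_derivative:
  assumes "i \<in> charts M" "j \<in> charts M" "p \<in> patch M i \<inter> patch M j"
  shows "(transition M i j has_derivative jacobian M i j p) (at (coord M i p))"
  unfolding jacobian_def using assms
  by (intro differentiable_has_derivative smooth_on_imp_differentiable[OF smooth_transition]) auto

lemma linear_jacobian:
  assumes "i \<in> charts M" "j \<in> charts M" "p \<in> patch M i \<inter> patch M j"
  shows "linear (jacobian M i j p)"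
  using has_derivative_linear[OF transition_has_derivative[OF assms]] .

text \<open>This is the chain rule: on the open image of the triple overlap, the transition from
  \<open>i\<close> to \<open>k\<close> factors through \<open>j\<close>.\<close>

lemma jacobian_cocycle:
  assumes "i \<in> charts M" "j \<in> charts M" "k \<in> charts M" "p \<in> patch M i \<inter> patch M j \<inter> patch M k"
  shows "jacobian M i k p u = jacobian M j k p (jacobian M i j p u)"
proof -
  let ?U = "coord M i ` (patch M i \<inter> (patch M j \<inter> patch M k))"
  have "open ?U"
    unfolding overlap_eq[OF assms(1)]
    by (intro open_coord_inv_preimage assms open_Int open_patch)
  have "(transition M j k has_derivative jacobian M j k p) (at (transition M i j (coord M i p)))"
    using transition_has_derivative[of j k p] assms by (simp add: transition_coord)
  from has_derivative_compose[OF transition_has_derivative[of i j p] this]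
  have "((\<lambda>x. transition M j k (transition M i j x)) has_derivative
      (\<lambda>u. jacobian M j k p (jacobian M i j p u))) (at (coord M i p))"
    using assms by auto
  then have "(transition M i k has_derivative (\<lambda>u. jacobian M j k p (jacobian M i j p u)))
      (at (coord M i p))"
    by (rule has_derivative_transform_within_open[OF _ \<open>open ?U\<close>])
       (use assms in \<open>auto simp: transition_coord\<close>)
  then show ?thesis by (simp add: jacobian_def frechet_derivativeI)
qed

lemma jacobian_self:
  assumes "i \<in> charts M" "p \<in> patch M i"
  shows "jacobian M i i p u = u"
proof -
  have "(transition M i i has_derivative (\<lambda>u. u)) (at (coord M i p))"
    by (rule has_derivative_transform_within_open[OF has_derivative_ident open_region[OF assms(1)]])
       (use assms in \<open>auto simp: coord_in transition_def coord_coord_inv\<close>)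
  then show ?thesis by (simp add: jacobian_def frechet_derivativeI)
qed

lemma vector_field_through:
  assumes i: "i \<in> charts M" and x: "x \<in> region M i"
  shows "\<exists>X. vector_field M X \<and> X i x = u"
proof -
  obtain r where r: "r > 0" "cball x r \<subseteq> region M i"
    using open_region[OF i] x open_contains_cball by blast
  obtain \<phi> :: "'e \<Rightarrow> real" where \<phi>: "smooth_on UNIV \<phi>" "\<phi> x = 1" "\<And>z. z \<notin> ball x r \<Longrightarrow> \<phi> z = 0"
    using smooth_bump_exists[OF r(1), of x] by blast
  \<comment> \<open>The constant vector \<open>u\<close> of chart \<open>i\<close>, cut off by
    \<open>\<phi>\<close> and expressed in chart \<open>j\<close> by the Jacobian.\<close>
  define Y where "Y j p = (if p \<in> patch M i then \<phi> (coord M i p) *\<^sub>R jacobian M i j p u else 0)" for j p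
  define X where "X j y = Y j (coord_inv M j y)" for j y
  \<comment> \<open>The support of the field lies in this image of a closed ball. It is compact,
    hence closed in the Hausdorff space of points, so every point outside the patch has a
    neighbourhood on which the extension by zero vanishes.\<close>
  define K where "K = coord_inv M i ` cball x r"
  have "compact K"
    unfolding K_def
    by (intro compact_continuous_image continuous_on_subset[OF continuous_coord_inv[OF i] r(2)]) simp
  then have "open (- K)" using compact_imp_closed by blast
  have Y0: "Y j p = 0" if "p \<notin> K" for j p
  proof (cases "p \<in> patch M i")
    case True
    have "coord M i p \<notin> cball x r"
      using that coord_inv_coord[OF i True] unfolding K_def by (metis imageI)
    then have "\<phi> (coord M i p) = 0" using \<phi>(3) by auto
    then show ?thesis by (simp add: Y_def)
  qed (simp add: Y_def)
  have XY: "X j (coord M j p) = Y j p" if "j \<in> charts M" "p \<in> patch M j" for j p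
    using that by (simp add: X_def coord_inv_coord)
  have "smooth_on (region M j) (X j)" if j: "j \<in> charts M" for j
  proof (rule smooth_on_locally)
    fix y assume y: "y \<in> region M j"
    define p where "p = coord_inv M j y"
    have p: "p \<in> patch M j" "coord M j p = y"
      using y j by (auto simp: p_def coord_inv_in coord_coord_inv)
    show "\<exists>U. open U \<and> y \<in> U \<and> smooth_on U (X j)"
    proof (cases "p \<in> patch M i")
      case True
      let ?U = "coord M j ` (patch M j \<inter> patch M i)"
      let ?V = "coord M i ` (patch M i \<inter> patch M j)"
      note U = open_overlap[OF j i]
      have "smooth_on ?V (\<lambda>z. \<phi> z *\<^sub>R frechet_derivative (transition M i j) (at z) u)"
        by (intro smooth_on_scaleR open_overlap i j smooth_on_frechet_derivative smooth_transition
            smooth_on_mono[OF _ \<phi>(1)]) simp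
      moreover have "transition M j i ` ?U \<subseteq> ?V"
        using i j by (auto simp: transition_coord)
      ultimately have "smooth_on ?U (\<lambda>y. \<phi> (transition M j i y) *\<^sub>R
          frechet_derivative (transition M i j) (at (transition M j i y)) u)"
        by (rule smooth_on_compose[OF U smooth_transition[OF j i]])
      then have "smooth_on ?U (X j)"
        by (rule smooth_on_cong[OF U]) (use i j in \<open>auto simp: transition_coord XY Y_def jacobian_def\<close>)
      then show ?thesis using U p True by blast
    next
      case False
      let ?U = "{y \<in> region M j. coord_inv M j y \<in> - K}"
      have U: "open ?U" by (rule open_coord_inv_preimage[OF j \<open>open (- K)\<close>])
      have "K \<subseteq> patch M i" unfolding K_def using r coord_inv_in[OF i] by blast
      then have "y \<in> ?U" using False y by (auto simp: p_def)
      moreover have "smooth_on ?U (X j)"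
        by (rule smooth_on_cong[OF U smooth_on_const[of _ 0]]) (auto simp: X_def Y0)
      ultimately show ?thesis using U by blast
    qed
  qed
  moreover have "X k (coord M k p) = jacobian M j k p (X j (coord M j p))"
    if "j \<in> charts M" "k \<in> charts M" "p \<in> patch M j \<inter> patch M k" for j k p
  proof -
    note lin = linear_jacobian[OF that]
    show ?thesis
      using that i jacobian_cocycle[of i j k p u] linear_0[OF lin]
      by (auto simp: XY Y_def linear_cmul[OF lin])
  qed
  moreover have "X i x = u"
    using XY[of i "coord_inv M i x"] i x \<phi>(2) by (simp add: coord_inv_in coord_coord_inv Y_def jacobian_self)
  ultimately show ?thesis unfolding vector_field_def by blast
qed

text \<open>\<open>cov\<close> depends on its first field only through the value at
  \<open>x\<close>, so a global field with the prescribed value there stands in for the constant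
  one.\<close>

lemma concurrent_in_chart:
  assumes "concurrent M h \<xi>" "i \<in> charts M" "x \<in> region M i"
  shows "cov (h i) (\<lambda>_. u) (\<xi> i) x = u"
proof -
  obtain X where X: "vector_field M X" "X i x = u" using vector_field_through[OF assms(2,3)] by blast
  then have "cov (h i) (X i) (\<xi> i) x = X i x" using assms unfolding concurrent_def by blast
  then show ?thesis by (simp add: cov_def X)
qed

end

section \<open>Differentiability of the Christoffel symbols\<close>

text \<open>Continuity of \<open>g\<close> is enough here: \<open>H z\<close> is of first order in
  \<open>z - x\<close>, and the factor \<open>g z - g x\<close> tends to 0, so their product is
  negligible.\<close>

lemma has_derivative_mult_vanishing:
  fixes g H :: "'e::real_normed_vector \<Rightarrow> real"
  assumes g: "isCont g x" and H: "(H has_derivative H') (at x)" "H x = 0"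
  shows "((\<lambda>z. g z * H z) has_derivative (\<lambda>h. g x * H' h)) (at x)"
proof -
  have bl: "bounded_linear H'" by (rule has_derivative_bounded_linear[OF H(1)])
  obtain B where B: "B > 0" "\<And>h. norm (H' h) \<le> norm h * B"
    using bounded_linear.pos_bounded[OF bl] by blast
  obtain d0 where d0: "d0 > 0" "\<And>y. norm (y - x) < d0 \<Longrightarrow> norm (H y - H x - H' (y - x)) \<le> 1 * norm (y - x)"
    using H(1) unfolding has_derivative_at_alt by (meson zero_less_one)
  \<comment> \<open>\<open>B\<close> bounds the linear part; the added 1 bounds the remainder, for
    which the tolerance 1 was chosen.\<close>
  have Hb: "\<bar>H y\<bar> \<le> (B + 1) * norm (y - x)" if "norm (y - x) < d0" for y
    using d0(2)[OF that] B(2)[of "y - x"] H(2) by (simp add: algebra_simps)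
  have "((\<lambda>z. (g z - g x) * H z) has_derivative (\<lambda>h. 0)) (at x)"
    unfolding has_derivative_at_alt
  proof (intro conjI allI impI bounded_linear_zero)
    fix e :: real assume "e > 0"
    then have "e / (B + 1) > 0" using B by simp
    then obtain d1 where d1: "d1 > 0" "\<And>y. dist y x < d1 \<Longrightarrow> \<bar>g y - g x\<bar> < e / (B + 1)"
      using g unfolding continuous_at_eps_delta dist_real_def by blast
    have "norm ((g y - g x) * H y - (g x - g x) * H x - 0) \<le> e * norm (y - x)"
      if "norm (y - x) < min d0 d1" for y
    proof -
      have "\<bar>g y - g x\<bar> * \<bar>H y\<bar> \<le> (e / (B + 1)) * ((B + 1) * norm (y - x))"
        using d1(2)[of y] Hb[of y] that \<open>e / (B + 1) > 0\<close>
        by (intro mult_mono) (auto simp: dist_norm)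
      then show ?thesis using B by (simp add: abs_mult)
    qed
    then show "\<exists>d>0. \<forall>y. norm (y - x) < d \<longrightarrow>
        norm ((g y - g x) * H y - (g x - g x) * H x - 0) \<le> e * norm (y - x)"
      using d0 d1 by (intro exI[of _ "min d0 d1"]) auto
  qed
  from has_derivative_add[OF this has_derivative_mult_right[OF H(1), of "g x"]]
  show ?thesis by (simp add: algebra_simps)
qed

text \<open>In coordinates dual to \<open>G x\<close> the equation \<open>G z (a z) = K z\<close> becomes a fixed point equation
  for \<open>a z\<close> whose linear part vanishes at \<open>x\<close>. So \<open>a\<close> is bounded near \<open>x\<close>, hence continuous at
  \<open>x\<close>, hence differentiable at \<open>x\<close>.\<close>

lemma differentiable_solution:
  fixes G :: "'e::euclidean_space \<Rightarrow> 'e \<Rightarrow> 'e \<Rightarrow> real" and a :: "'e \<Rightarrow> 'e"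
  assumes S: "open S" "x \<in> S" and G: "\<And>z. z \<in> S \<Longrightarrow> scalar_product (G z)"
    and dG: "\<And>v w. (\<lambda>z. G z v w) differentiable (at x)"
    and dK: "\<And>w. (\<lambda>z. K z w) differentiable (at x)"
    and eq: "\<And>z w. z \<in> S \<Longrightarrow> G z (a z) w = K z w"
  shows "a differentiable (at x)"
proof -
  \<comment> \<open>Testing the equation against the resulting vectors \<open>d b\<close> reads off
    the coordinates of \<open>a z\<close>, up to the error \<open>H\<close> from replacing
    \<open>G z\<close> by \<open>G x\<close>.\<close>
  have "\<exists>d. \<forall>w. G x d w = w \<bullet> b" for b
    by (rule scalar_product_represents[OF G[OF S(2)]]) (simp add: bounded_linear.linear[OF bounded_linear_inner_left])
  then obtain d where d: "G x (d b) w = w \<bullet> b" for b w by metis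
  define H where "H b c z = G z c (d b) - G x c (d b)" for b c z
  have bil: "bilinear (G z)" if "z \<in> S" for z using G[OF that] by (simp add: scalar_product_def)
  have expand: "G z v w = (\<Sum>c\<in>Basis. (v \<bullet> c) * G z c w)" if "z \<in> S" for z v w
    using linear_eq_sum_Basis[of "\<lambda>v. G z v w" v] bil[OF that] by (simp add: bilinear_def)
  have fix_eq: "a z \<bullet> b = K z (d b) - (\<Sum>c\<in>Basis. (a z \<bullet> c) * H b c z)" if "z \<in> S" for z b
  proof -
    have "(\<Sum>c\<in>Basis. (a z \<bullet> c) * H b c z) = G z (a z) (d b) - G x (a z) (d b)"
      unfolding expand[OF that, of "a z"] expand[OF S(2), of "a z"] H_def
      by (simp add: right_diff_distrib sum_subtractf)
    moreover have "G x (a z) (d b) = a z \<bullet> b"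
      using d G[OF S(2)] by (simp add: scalar_product_def)
    ultimately show ?thesis by (simp add: eq[OF that])
  qed
  have dH: "H b c differentiable (at x)" for b c
    unfolding H_def by (intro differentiable_diff dG differentiable_const)
  have H0: "(H b c \<longlongrightarrow> 0) (at x)" for b c
    using differentiable_imp_continuous_within[OF dH[of b c]] by (simp add: isCont_def H_def)
  have K0: "((\<lambda>z. K z w) \<longlongrightarrow> K x w) (at x)" for w
    using differentiable_imp_continuous_within[OF dK[of w]] by (simp add: isCont_def)
  define m where "m z = (\<Sum>c\<in>Basis. \<bar>a z \<bullet> c\<bar>)" for z
  define k where "k z = (\<Sum>b\<in>Basis. \<bar>K z (d b)\<bar>)" for z
  \<comment> \<open>Summing the error over all \<open>b\<close> in \<open>Basis\<close> costs a
    factor \<open>DIM('e)\<close>. This value turns the total into \<open>m z / 2\<close>, which can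
    be absorbed on the left and so bounds \<open>m\<close>.\<close>
  define \<eta> :: real where "\<eta> = 1 / (2 * real DIM('e))"
  have "\<eta> > 0" by (simp add: \<eta>_def)
  have "\<forall>\<^sub>F z in at x. \<bar>H b c z\<bar> < \<eta>" for b c
    using tendstoD[OF H0[of b c] \<open>\<eta> > 0\<close>] by (simp add: dist_real_def)
  then have small: "\<forall>\<^sub>F z in at x. \<forall>b\<in>Basis. \<forall>c\<in>Basis. \<bar>H b c z\<bar> < \<eta>"
    by (simp add: eventually_ball_finite_distrib)
  have "(k \<longlongrightarrow> k x) (at x)" unfolding k_def by (intro tendsto_intros K0)
  then have "\<forall>\<^sub>F z in at x. k z < k x + 1" by (rule order_tendstoD) simp
  then have m_bound: "\<forall>\<^sub>F z in at x. m z \<le> 2 * (k x + 1)"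
    using small eventually_at_in_open'[OF S]
  proof eventually_elim
    case (elim z)
    have "m z \<le> (\<Sum>b\<in>Basis. \<bar>K z (d b)\<bar> + (\<Sum>c\<in>Basis. \<bar>a z \<bullet> c\<bar> * \<eta>))"
      unfolding m_def
    proof (rule sum_mono)
      fix b :: 'e assume b: "b \<in> Basis"
      have "\<bar>\<Sum>c\<in>Basis. (a z \<bullet> c) * H b c z\<bar> \<le> (\<Sum>c\<in>Basis. \<bar>(a z \<bullet> c) * H b c z\<bar>)"
        by (rule sum_abs)
      also have "\<dots> \<le> (\<Sum>c\<in>Basis. \<bar>a z \<bullet> c\<bar> * \<eta>)"
        unfolding abs_mult using elim(2) b by (intro sum_mono mult_left_mono) (auto intro: less_imp_le)
      finally show "\<bar>a z \<bullet> b\<bar> \<le> \<bar>K z (d b)\<bar> + (\<Sum>c\<in>Basis. \<bar>a z \<bullet> c\<bar> * \<eta>)"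
        using fix_eq[OF elim(3), of b] by linarith
    qed
    also have "\<dots> = k z + m z / 2"
      unfolding sum.distrib sum_distrib_right[symmetric] k_def m_def by (simp add: \<eta>_def)
    finally have "m z \<le> 2 * k z" by simp
    then show ?case using elim(1) by simp
  qed
  have cont: "isCont (\<lambda>z. a z \<bullet> b) x" if b: "b \<in> Basis" for b
  proof -
    have "((\<lambda>z. (a z \<bullet> c) * H b c z) \<longlongrightarrow> 0) (at x)" if "c \<in> Basis" for c
    proof (rule tendsto_0_le[where K = "2 * (k x + 1)", OF H0[of b c]])
      show "\<forall>\<^sub>F z in at x. norm ((a z \<bullet> c) * H b c z) \<le> norm (H b c z) * (2 * (k x + 1))"
        using m_bound
      proof eventually_elim
        case (elim z)
        have "\<bar>a z \<bullet> c\<bar> \<le> m z"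
          unfolding m_def using that by (intro member_le_sum) auto
        then have "\<bar>a z \<bullet> c\<bar> \<le> 2 * (k x + 1)" using elim by simp
        then show ?case by (simp add: abs_mult mult.commute mult_left_mono)
      qed
    qed
    then have "((\<lambda>z. K z (d b) - (\<Sum>c\<in>Basis. (a z \<bullet> c) * H b c z)) \<longlongrightarrow> K x (d b) - (\<Sum>c\<in>(Basis :: 'e set). 0)) (at x)"
      by (intro tendsto_diff tendsto_sum K0) auto
    then have lim: "((\<lambda>z. K z (d b) - (\<Sum>c\<in>Basis. (a z \<bullet> c) * H b c z)) \<longlongrightarrow> K x (d b)) (at x)"
      by simp
    have "\<forall>\<^sub>F z in at x. K z (d b) - (\<Sum>c\<in>Basis. (a z \<bullet> c) * H b c z) = a z \<bullet> b"
      using eventually_at_in_open'[OF S] by eventually_elim (simp add: fix_eq)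
    then have "((\<lambda>z. a z \<bullet> b) \<longlongrightarrow> K x (d b)) (at x)"
      by (rule Lim_transform_eventually[OF lim])
    moreover have "a x \<bullet> b = K x (d b)" using fix_eq[OF S(2)] by (simp add: H_def)
    ultimately show ?thesis by (simp add: isCont_def)
  qed
  have "(\<lambda>z. a z \<bullet> b) differentiable (at x)" if "b \<in> Basis" for b
  proof -
    have "(\<lambda>z. (a z \<bullet> c) * H b c z) differentiable (at x)" if "c \<in> Basis" for c
      using has_derivative_mult_vanishing[OF cont[OF that] differentiable_has_derivative[OF dH[of b c]]]
      by (auto simp: H_def differentiable_def)
    then have "(\<lambda>z. K z (d b) - (\<Sum>c\<in>Basis. (a z \<bullet> c) * H b c z)) differentiable (at x)"
      by (intro differentiable_diff differentiable_sum dK) auto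
    then show ?thesis by (rule differentiable_cong_open[OF _ S]) (simp add: fix_eq)
  qed
  then show ?thesis by (subst differentiable_componentwise_within) blast
qed

section \<open>Metrics and concurrent fields in a chart\<close>

locale chart_metric =
  fixes S :: "'e::euclidean_space set" and G :: "'e \<Rightarrow> 'e \<Rightarrow> 'e \<Rightarrow> real"
  assumes open_S: "open S"
    and scalar_product_G: "z \<in> S \<Longrightarrow> scalar_product (G z)"
    and smooth_G: "smooth_on S (\<lambda>z. G z u v)"
begin

lemma G_bilinear: "z \<in> S \<Longrightarrow> bilinear (G z)"
  and G_sym: "z \<in> S \<Longrightarrow> G z u v = G z v u"
  and G_nondegenerate: "z \<in> S \<Longrightarrow> (\<And>v. G z u v = 0) \<Longrightarrow> u = 0"
  using scalar_product_G unfolding scalar_product_def by blast+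

lemma G_differentiable: "z \<in> S \<Longrightarrow> (\<lambda>z. G z u v) differentiable (at z)"
  by (rule smooth_on_imp_differentiable[OF smooth_G])

lemma christoffelI:
  assumes "x \<in> S" "levi_civita G x \<Gamma>"
  shows "christoffel G x = \<Gamma>"
  unfolding christoffel_def
  by (rule the1_equality[OF levi_civita_ex1[OF open_S assms(1) scalar_product_G]])
     (use assms G_differentiable in auto)

lemma levi_civita_christoffel:
  assumes "x \<in> S"
  shows "levi_civita G x (christoffel G x)"
  unfolding christoffel_def
  by (rule theI'[OF levi_civita_ex1[OF open_S assms scalar_product_G]])
     (use assms G_differentiable in auto)

lemma
  assumes "x \<in> S"
  shows christoffel_bilinear: "bilinear (christoffel G x)"
    and christoffel_sym: "christoffel G x u v = christoffel G x v u"
    and christoffel_metric: "frechet_derivative (\<lambda>z. G z v w) (at x) u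
        = G x (christoffel G x u v) w + G x v (christoffel G x u w)"
  using levi_civita_christoffel[OF assms] unfolding levi_civita_def by blast+

text \<open>Adding and subtracting metric compatibility in three arrangements of the arguments
  cancels all but one pairing, by torsion freeness. The right side is smooth and serves as the datum
  \<open>K\<close> of \<open>differentiable_solution\<close>.\<close>

lemma christoffel_koszul:
  assumes "x \<in> S"
  shows "G x (christoffel G x u v) w = 1 / 2 *
    (frechet_derivative (\<lambda>z. G z v w) (at x) u + frechet_derivative (\<lambda>z. G z u w) (at x) v
      - frechet_derivative (\<lambda>z. G z u v) (at x) w)"
  unfolding christoffel_metric[OF assms]
  using christoffel_sym[OF assms, of v u] christoffel_sym[OF assms, of w u]
    christoffel_sym[OF assms, of w v] G_sym[OF assms, of v "christoffel G x u w"]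
  by simp

text \<open>One derivative is all that the curvature takes of the Christoffel symbols.\<close>

lemma christoffel_differentiable:
  assumes "x \<in> S"
  shows "(\<lambda>z. christoffel G z u v) differentiable (at x)"
proof (rule differentiable_solution[OF open_S assms scalar_product_G _ _ christoffel_koszul])
  show "(\<lambda>z. 1 / 2 *
      (frechet_derivative (\<lambda>z. G z v w) (at z) u + frechet_derivative (\<lambda>z. G z u w) (at z) v
        - frechet_derivative (\<lambda>z. G z u v) (at z) w)) differentiable (at x)" for w
    by (intro differentiable_mult differentiable_const differentiable_add differentiable_diff
        smooth_on_imp_differentiable[OF smooth_on_frechet_derivative[OF smooth_G] assms])
qed (use G_differentiable assms in auto)

lemma G_expand:
  assumes "z \<in> S"
  shows "G z u v = (\<Sum>b\<in>Basis. \<Sum>c\<in>Basis. (u \<bullet> b) * ((v \<bullet> c) * G z b c))"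
proof -
  note bil = G_bilinear[OF assms]
  have "G z u v = (\<Sum>b\<in>Basis. (u \<bullet> b) * G z b v)"
    using linear_eq_sum_Basis[of "\<lambda>u. G z u v" u] bil by (simp add: bilinear_def)
  moreover have "G z b v = (\<Sum>c\<in>Basis. (v \<bullet> c) * G z b c)" for b
    using linear_eq_sum_Basis[of "G z b" v] bil by (simp add: bilinear_def)
  ultimately show ?thesis by (simp add: sum_distrib_left)
qed

lemma smooth_pairing:
  assumes "smooth_on S Y" "smooth_on S W"
  shows "smooth_on S (\<lambda>z. G z (Y z) (W z))"
proof (rule smooth_on_cong[OF open_S])
  show "smooth_on S (\<lambda>z. \<Sum>b\<in>Basis. \<Sum>c\<in>Basis. (Y z \<bullet> b) * ((W z \<bullet> c) * G z b c))"
    by (intro smooth_on_sum smooth_on_mult smooth_on_bounded_linear[OF bounded_linear_inner_left]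
        open_S finite_Basis assms smooth_G)
qed (simp add: G_expand[symmetric])

text \<open>Metric compatibility for variable fields. The definition grants it for constant fields
  only; expanding both arguments in \<open>Basis\<close> and using the product rule adds the
  derivatives of the coefficients.\<close>

lemma pairing_has_derivative:
  assumes x: "x \<in> S" and Y: "Y differentiable (at x)" and W: "W differentiable (at x)"
  shows "((\<lambda>z. G z (Y z) (W z)) has_derivative
    (\<lambda>h. G x (cov G (\<lambda>_. h) Y x) (W x) + G x (Y x) (cov G (\<lambda>_. h) W x))) (at x)"
proof -
  define DY where "DY = frechet_derivative Y (at x)"
  define DW where "DW = frechet_derivative W (at x)"
  define D where "D b c = frechet_derivative (\<lambda>z. G z b c) (at x)" for b c
  have dY: "((\<lambda>z. Y z \<bullet> b) has_derivative (\<lambda>h. DY h \<bullet> b)) (at x)" for b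
    unfolding DY_def
    by (rule bounded_linear.has_derivative[OF bounded_linear_inner_left differentiable_has_derivative[OF Y]])
  have dW: "((\<lambda>z. W z \<bullet> b) has_derivative (\<lambda>h. DW h \<bullet> b)) (at x)" for b
    unfolding DW_def
    by (rule bounded_linear.has_derivative[OF bounded_linear_inner_left differentiable_has_derivative[OF W]])
  have dG: "((\<lambda>z. G z b c) has_derivative D b c) (at x)" for b c
    unfolding D_def by (rule differentiable_has_derivative[OF G_differentiable[OF x]])
  \<comment> \<open>The derivative of the metric inherits bilinearity in \<open>u\<close> and
    \<open>v\<close>, so the values \<open>Y x\<close> and \<open>W x\<close> can be put back into
    it.\<close>
  have D_expand: "D u v h = (\<Sum>b\<in>Basis. \<Sum>c\<in>Basis. (u \<bullet> b) * ((v \<bullet> c) * D b c h))" for u v h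
  proof -
    have "((\<lambda>z. \<Sum>b\<in>Basis. \<Sum>c\<in>Basis. (u \<bullet> b) * ((v \<bullet> c) * G z b c)) has_derivative
        (\<lambda>h. \<Sum>b\<in>Basis. \<Sum>c\<in>Basis. (u \<bullet> b) * ((v \<bullet> c) * D b c h))) (at x)"
      by (intro has_derivative_sum has_derivative_mult_right dG)
    then have "((\<lambda>z. G z u v) has_derivative
        (\<lambda>h. \<Sum>b\<in>Basis. \<Sum>c\<in>Basis. (u \<bullet> b) * ((v \<bullet> c) * D b c h))) (at x)"
      by (rule has_derivative_transform_within_open[OF _ open_S x]) (simp add: G_expand[symmetric])
    then show ?thesis unfolding D_def[of u v] by (simp add: frechet_derivativeI)
  qed
  have "((\<lambda>z. \<Sum>b\<in>Basis. \<Sum>c\<in>Basis. (Y z \<bullet> b) * ((W z \<bullet> c) * G z b c)) has_derivative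
      (\<lambda>h. \<Sum>b\<in>Basis. \<Sum>c\<in>Basis. (Y x \<bullet> b) * ((W x \<bullet> c) * D b c h + (DW h \<bullet> c) * G x b c)
        + (DY h \<bullet> b) * ((W x \<bullet> c) * G x b c))) (at x)"
    by (intro has_derivative_sum has_derivative_mult dY dW dG)
  then have "((\<lambda>z. G z (Y z) (W z)) has_derivative
      (\<lambda>h. \<Sum>b\<in>Basis. \<Sum>c\<in>Basis. (Y x \<bullet> b) * ((W x \<bullet> c) * D b c h + (DW h \<bullet> c) * G x b c)
        + (DY h \<bullet> b) * ((W x \<bullet> c) * G x b c))) (at x)"
    by (rule has_derivative_transform_within_open[OF _ open_S x]) (simp add: G_expand[symmetric])
  moreover have "(\<Sum>b\<in>Basis. \<Sum>c\<in>Basis. (Y x \<bullet> b) * ((W x \<bullet> c) * D b c h + (DW h \<bullet> c) * G x b c)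
        + (DY h \<bullet> b) * ((W x \<bullet> c) * G x b c))
      = D (Y x) (W x) h + G x (Y x) (DW h) + G x (DY h) (W x)" for h
    unfolding D_expand[of "Y x"] G_expand[OF x, of "Y x"] G_expand[OF x, of "DY h"]
    by (simp add: distrib_left sum.distrib)
  ultimately show ?thesis
    unfolding cov_def DY_def[symmetric] DW_def[symmetric]
    by (simp add: D_def christoffel_metric[OF x] bilinear_ladd[OF G_bilinear[OF x]]
        bilinear_radd[OF G_bilinear[OF x]] algebra_simps)
qed

text \<open>Metric compatibility expands the derivative of \<open>G\<close> along \<open>X\<close>,
  and torsion freeness swaps the arguments of the Christoffel terms, which then combine with the
  brackets into covariant derivatives of \<open>X\<close>.\<close>

lemma lie_metric_eq:
  assumes x: "x \<in> S" and X: "X differentiable (at x)"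
  shows "lie_metric X G x u v = G x (cov G (\<lambda>_. u) X x) v + G x u (cov G (\<lambda>_. v) X x)"
  using linear_frechet_derivative[OF X]
  by (simp add: lie_metric_def bracket_def cov_def christoffel_metric[OF x]
      christoffel_sym[OF x, of "X x"] bilinear_ladd[OF G_bilinear[OF x]]
      bilinear_radd[OF G_bilinear[OF x]] bilinear_lneg[OF G_bilinear[OF x]] bilinear_rneg[OF G_bilinear[OF x]])

lemma curvature_const:
  assumes x: "x \<in> S"
  shows "curvature G (\<lambda>_. u) (\<lambda>_. v) (\<lambda>_. w) x
    = frechet_derivative (\<lambda>z. christoffel G z v w) (at x) u + christoffel G x u (christoffel G x v w)
      - (frechet_derivative (\<lambda>z. christoffel G z u w) (at x) v + christoffel G x v (christoffel G x u w))"
proof -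
  have "cov G (\<lambda>_. a) (\<lambda>_. b) = (\<lambda>z. christoffel G z a b)" for a b
    by (simp add: cov_def fun_eq_iff)
  then show ?thesis
    by (simp add: curvature_def cov_def[of _ _ "\<lambda>z. christoffel G z a b" for a b]
        cov_def[of _ "bracket _ _"] bracket_def bilinear_lzero[OF christoffel_bilinear[OF x]])
qed

end

section \<open>Concurrent fields in a chart: potential, closed dual form, curvature\<close>

locale chart_concurrent = chart_metric S G
  for S :: "'e::euclidean_space set" and G :: "'e \<Rightarrow> 'e \<Rightarrow> 'e \<Rightarrow> real" +
  fixes Z :: "'e \<Rightarrow> 'e"
  assumes smooth_Z: "smooth_on S Z"
    and cov_Z: "x \<in> S \<Longrightarrow> cov G (\<lambda>_. u) Z x = u"
begin

lemma Z_differentiable: "x \<in> S \<Longrightarrow> Z differentiable (at x)"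
  by (rule smooth_on_imp_differentiable[OF smooth_Z])

lemma lie_metric_Z: "x \<in> S \<Longrightarrow> lie_metric Z G x u v = 2 * G x u v"
  by (simp add: lie_metric_eq Z_differentiable cov_Z)

lemma potential_has_derivative:
  assumes x: "x \<in> S"
  shows "((\<lambda>z. 1 / 2 * G z (Z z) (Z z)) has_derivative G x (Z x)) (at x)"
proof -
  have "((\<lambda>z. 1 / 2 * G z (Z z) (Z z)) has_derivative
      (\<lambda>h. 1 / 2 * (G x (cov G (\<lambda>_. h) Z x) (Z x) + G x (Z x) (cov G (\<lambda>_. h) Z x)))) (at x)"
    by (intro has_derivative_mult_right pairing_has_derivative x Z_differentiable)
  also have "(\<lambda>h. 1 / 2 * (G x (cov G (\<lambda>_. h) Z x) (Z x) + G x (Z x) (cov G (\<lambda>_. h) Z x))) = G x (Z x)"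
    by (simp add: cov_Z[OF x] G_sym[OF x, of _ "Z x"])
  finally show ?thesis .
qed

text \<open>The derivative equals \<open>G x u w + G x (Z x) (christoffel G x u w)\<close>, and both
  summands are symmetric in \<open>u\<close> and \<open>w\<close>.\<close>

lemma dual_form_closed:
  assumes x: "x \<in> S"
  shows "frechet_derivative (\<lambda>z. G z (Z z) w) (at x) u = frechet_derivative (\<lambda>z. G z (Z z) u) (at x) w"
proof -
  have "frechet_derivative (\<lambda>z. G z (Z z) w) (at x) u = G x u w + G x (Z x) (christoffel G x u w)" for u w
    by (subst frechet_derivativeI[OF pairing_has_derivative[OF x Z_differentiable[OF x] differentiable_const]])
       (simp add: cov_Z[OF x], simp add: cov_def)
  then show ?thesis by (simp add: G_sym[OF x, of w u] christoffel_sym[OF x, of w u])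
qed

text \<open>Concurrence is the first order system \<open>DZ v = v - \<Gamma> v Z\<close>. Its
  integrability condition, obtained by differentiating again and exchanging the directions, is the
  vanishing of this curvature; the terms \<open>\<Gamma> v u\<close> and \<open>\<Gamma> u v\<close>
  cancel.\<close>

lemma curvature_Z:
  assumes x: "x \<in> S"
  shows "curvature G (\<lambda>_. u) (\<lambda>_. v) (\<lambda>_. Z x) x = 0"
proof -
  let ?\<Gamma> = "christoffel G x"
  let ?D = "\<lambda>u v. frechet_derivative (\<lambda>z. christoffel G z v (Z x)) (at x) u"
  have lin: "linear (christoffel G z v)" if "z \<in> S" for z v
    using christoffel_bilinear[OF that] by (simp add: bilinear_def)
  have DZ: "frechet_derivative Z (at z) v = v - christoffel G z v (Z z)" if "z \<in> S" for z v
    using cov_Z[OF that, of v] by (simp add: cov_def algebra_simps)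
  have second: "frechet_derivative (\<lambda>z. frechet_derivative Z (at z) v) (at x) u
      = - (?D u v + ?\<Gamma> v (frechet_derivative Z (at x) u))" for u v
  proof -
    define DZx where "DZx = frechet_derivative Z (at x)"
    define C where "C b = frechet_derivative (\<lambda>z. christoffel G z v b) (at x)" for b
    have dZ: "((\<lambda>z. Z z \<bullet> b) has_derivative (\<lambda>h. DZx h \<bullet> b)) (at x)" for b
      unfolding DZx_def
      by (rule bounded_linear.has_derivative[OF bounded_linear_inner_left
            differentiable_has_derivative[OF Z_differentiable[OF x]]])
    have dC: "((\<lambda>z. christoffel G z v b) has_derivative C b) (at x)" for b
      unfolding C_def by (rule differentiable_has_derivative[OF christoffel_differentiable[OF x]])
    \<comment> \<open>Differentiability of the symbols is known for constant arguments, while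
      \<open>Z z\<close> varies; the basis expansion separates the two dependences.\<close>
    have C: "C w h = (\<Sum>b\<in>Basis. (w \<bullet> b) *\<^sub>R C b h)" for w h
    proof -
      have "((\<lambda>z. \<Sum>b\<in>Basis. (w \<bullet> b) *\<^sub>R christoffel G z v b) has_derivative
          (\<lambda>h. \<Sum>b\<in>Basis. (w \<bullet> b) *\<^sub>R C b h)) (at x)"
        by (intro has_derivative_sum has_derivative_scaleR_right dC)
      then have "((\<lambda>z. christoffel G z v w) has_derivative (\<lambda>h. \<Sum>b\<in>Basis. (w \<bullet> b) *\<^sub>R C b h)) (at x)"
        by (rule has_derivative_transform_within_open[OF _ open_S x])
           (simp add: linear_eq_sum_Basis[OF lin, symmetric])
      then show ?thesis unfolding C_def[of w] by (simp add: frechet_derivativeI)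
    qed
    have "((\<lambda>z. v - (\<Sum>b\<in>Basis. (Z z \<bullet> b) *\<^sub>R christoffel G z v b)) has_derivative
        (\<lambda>h. 0 - (\<Sum>b\<in>Basis. (Z x \<bullet> b) *\<^sub>R C b h + (DZx h \<bullet> b) *\<^sub>R christoffel G x v b))) (at x)"
      by (intro has_derivative_diff has_derivative_const has_derivative_sum has_derivative_scaleR dC dZ)
    then have "((\<lambda>z. frechet_derivative Z (at z) v) has_derivative
        (\<lambda>h. 0 - (\<Sum>b\<in>Basis. (Z x \<bullet> b) *\<^sub>R C b h + (DZx h \<bullet> b) *\<^sub>R christoffel G x v b))) (at x)"
      by (rule has_derivative_transform_within_open[OF _ open_S x])
         (simp add: linear_eq_sum_Basis[OF lin, symmetric] DZ)
    then have "frechet_derivative (\<lambda>z. frechet_derivative Z (at z) v) (at x) u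
        = - (\<Sum>b\<in>Basis. (Z x \<bullet> b) *\<^sub>R C b u + (DZx u \<bullet> b) *\<^sub>R christoffel G x v b)"
      by (simp add: frechet_derivativeI)
    also have "\<dots> = - (C (Z x) u + ?\<Gamma> v (DZx u))"
      by (simp add: sum.distrib C[of "Z x"] linear_eq_sum_Basis[OF lin[OF x], of v "DZx u", symmetric])
    finally show ?thesis by (simp add: C_def DZx_def)
  qed
  have "?D u v + ?\<Gamma> v (u - ?\<Gamma> u (Z x)) = ?D v u + ?\<Gamma> u (v - ?\<Gamma> v (Z x))"
    using second_derivative_commute[OF open_S x smooth_Z, of v u]
    unfolding second[of v u] second[of u v] DZ[OF x] neg_equal_iff_equal .
  then show ?thesis
    unfolding curvature_const[OF x] linear_diff[OF lin[OF x]] christoffel_sym[OF x, of v u]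
    by (simp add: algebra_simps)
qed

lemma ricci_Z: "x \<in> S \<Longrightarrow> ricci G x v (Z x) = 0"
  by (simp add: ricci_def curvature_Z)

end

text \<open>In each chart the soliton equation is half of \<open>\<L>\<^sub>\<xi> h = 2 h\<close>.
  What remains is to glue the chartwise potentials into one function on the manifold.\<close>

lemma gradient_ricci_soliton_concurrent:
  fixes M :: "('i, 'a::{t2_space,second_countable_topology}, 'e::euclidean_space) atlas"
  assumes pr: "pseudo_riemannian_manifold M h" and vf: "vector_field M \<xi>"
    and cc: "\<And>i. i \<in> charts M \<Longrightarrow> chart_concurrent (region M i) (h i) (\<xi> i)"
    and flat: "ricci_flat M h"
  shows "gradient_ricci_soliton M h \<xi> 1"
proof -
  interpret smooth_atlas M
    using pr by unfold_locales (simp add: pseudo_riemannian_manifold_def)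
  have h_law: "h i (coord M i p) u v = h j (coord M j p) (jacobian M i j p u) (jacobian M i j p v)"
    if "i \<in> charts M" "j \<in> charts M" "p \<in> patch M i \<inter> patch M j" for i j p u v
    using pr unfolding pseudo_riemannian_manifold_def by (elim conjE) (use that in blast)
  have vf_law: "\<xi> j (coord M j p) = jacobian M i j p (\<xi> i (coord M i p))"
    if "i \<in> charts M" "j \<in> charts M" "p \<in> patch M i \<inter> patch M j" for i j p
    using vf unfolding vector_field_def by (elim conjE) (use that in blast)
  define ch where "ch p = (SOME i. i \<in> charts M \<and> p \<in> patch M i)" for p
  define F where "F p = 1 / 2 * h (ch p) (coord M (ch p) p) (\<xi> (ch p) (coord M (ch p) p)) (\<xi> (ch p) (coord M (ch p) p))" for p
  \<comment> \<open>The laws for \<open>h\<close> and \<open>\<xi>\<close> involve the same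
    Jacobian, so the squared length does not depend on the chart that \<open>ch\<close>
    selects.\<close>
  have F: "F (coord_inv M i x) = 1 / 2 * h i x (\<xi> i x) (\<xi> i x)"
    if i: "i \<in> charts M" and x: "x \<in> region M i" for i x
  proof -
    define p where "p = coord_inv M i x"
    have p: "p \<in> patch M i" "coord M i p = x"
      using i x by (auto simp: p_def coord_inv_in coord_coord_inv)
    have "\<exists>i. i \<in> charts M \<and> p \<in> patch M i" using i p(1) by blast
    then have c: "ch p \<in> charts M \<and> p \<in> patch M (ch p)" unfolding ch_def by (rule someI_ex)
    have pp: "p \<in> patch M i \<inter> patch M (ch p)" using p c by simp
    have "\<xi> (ch p) (coord M (ch p) p) = jacobian M i (ch p) p (\<xi> i x)"
      using vf_law[OF i conjunct1[OF c] pp] unfolding p(2) .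
    moreover have "h i x (\<xi> i x) (\<xi> i x) = h (ch p) (coord M (ch p) p)
        (jacobian M i (ch p) p (\<xi> i x)) (jacobian M i (ch p) p (\<xi> i x))"
      using h_law[OF i conjunct1[OF c] pp] unfolding p(2) .
    ultimately show ?thesis unfolding F_def p_def[symmetric] by simp
  qed
  have "smooth_function M F"
    unfolding smooth_function_def
  proof
    fix i assume i: "i \<in> charts M"
    then interpret chart_concurrent "region M i" "h i" "\<xi> i" by (rule cc)
    show "smooth_on (region M i) (F \<circ> coord_inv M i)"
      by (rule smooth_on_cong[OF open_S smooth_on_mult[OF open_S smooth_on_const[of _ "1 / 2"]
              smooth_pairing[OF smooth_Z smooth_Z]]]) (simp add: F i)
  qed
  moreover have "is_gradient M h F \<xi>"
    unfolding is_gradient_def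
  proof (intro ballI allI)
    fix i x v assume i: "i \<in> charts M" and x: "x \<in> region M i"
    from i interpret chart_concurrent "region M i" "h i" "\<xi> i" by (rule cc)
    have "((F \<circ> coord_inv M i) has_derivative h i x (\<xi> i x)) (at x)"
      by (rule has_derivative_transform_within_open[OF potential_has_derivative[OF x] open_S x]) (simp add: F i)
    then show "h i x (\<xi> i x) v = frechet_derivative (F \<circ> coord_inv M i) (at x) v"
      by (simp add: frechet_derivativeI)
  qed
  moreover have "ricci_soliton M h \<xi> 1"
    unfolding ricci_soliton_def
  proof (intro conjI ballI allI pr vf)
    fix i x u v assume i: "i \<in> charts M" and x: "x \<in> region M i"
    from i interpret chart_concurrent "region M i" "h i" "\<xi> i" by (rule cc)
    show "1 / 2 * lie_metric (\<xi> i) (h i) x u v + ricci (h i) x u v = 1 * h i x u v"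
      using flat i x by (simp add: lie_metric_Z ricci_flat_def)
  qed
  ultimately show ?thesis unfolding gradient_ricci_soliton_def by blast
qed

lemma pseudo_riemannian_chart_metric:
  assumes "pseudo_riemannian_manifold M h" "i \<in> charts M"
  shows "chart_metric (region M i) (h i)"
  using assms unfolding pseudo_riemannian_manifold_def smooth_manifold_def
  by unfold_locales blast+

lemma concurrent_chart_concurrent:
  assumes pr: "pseudo_riemannian_manifold M h" and c: "concurrent M h \<xi>" and i: "i \<in> charts M"
  shows "chart_concurrent (region M i) (h i) (\<xi> i)"
proof -
  interpret smooth_atlas M
    using pr by unfold_locales (simp add: pseudo_riemannian_manifold_def)
  interpret chart_metric "region M i" "h i"
    by (rule pseudo_riemannian_chart_metric[OF pr i])
  show ?thesis
    using c i concurrent_in_chart[OF c i]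
    by unfold_locales (auto simp: concurrent_def vector_field_def)
qed

section \<open>Warped products in charts\<close>

text \<open>\<open>F\<close> is the warping function read in a chart of the first factor. That
  \<open>P\<close> is a metric is assumed here because the soliton hypothesis on the product
  supplies it.\<close>

locale chart_warped = m1: chart_metric S\<^sub>1 G\<^sub>1 + m2: chart_metric S\<^sub>2 G\<^sub>2
  for S\<^sub>1 :: "'d::euclidean_space set" and G\<^sub>1 and S\<^sub>2 :: "'e::euclidean_space set" and G\<^sub>2 +
  fixes P :: "'d \<times> 'e \<Rightarrow> 'd \<times> 'e \<Rightarrow> 'd \<times> 'e \<Rightarrow> real" and F :: "'d \<Rightarrow> real"
  assumes metric_P: "chart_metric (S\<^sub>1 \<times> S\<^sub>2) P"
    and P: "P z u v = G\<^sub>1 (fst z) (fst u) (fst v) + (F (fst z))\<^sup>2 * G\<^sub>2 (snd z) (snd u) (snd v)"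
    and F_pos: "x \<in> S\<^sub>1 \<Longrightarrow> F x > 0"
    and F_differentiable: "x \<in> S\<^sub>1 \<Longrightarrow> F differentiable (at x)"
begin

sublocale p: chart_metric "S\<^sub>1 \<times> S\<^sub>2" P
  by (rule metric_P)

lemma open_product: "open (S\<^sub>1 \<times> S\<^sub>2)"
  by (intro open_Times m1.open_S m2.open_S)

lemma fst_has_derivative:
  assumes "Y differentiable (at x)"
  shows "((\<lambda>z. Y (fst z)) has_derivative (\<lambda>u. frechet_derivative Y (at x) (fst u))) (at (x, y))"
  using has_derivative_compose[OF has_derivative_fst[OF has_derivative_ident],
      of Y "frechet_derivative Y (at x)" "(x, y)" UNIV] differentiable_has_derivative[OF assms]
  by simp

lemma snd_has_derivative:
  assumes "Y differentiable (at y)"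
  shows "((\<lambda>z. Y (snd z)) has_derivative (\<lambda>u. frechet_derivative Y (at y) (snd u))) (at (x, y))"
  using has_derivative_compose[OF has_derivative_snd[OF has_derivative_ident],
      of Y "frechet_derivative Y (at y)" "(x, y)" UNIV] differentiable_has_derivative[OF assms]
  by simp

lemma warped_has_derivative:
  assumes x: "x \<in> S\<^sub>1" and Y: "Y differentiable (at y)"
  shows "((\<lambda>z. (F (fst z))\<^sup>2 * Y (snd z)) has_derivative
    (\<lambda>u. (F x)\<^sup>2 * frechet_derivative Y (at y) (snd u)
      + 2 * F x * frechet_derivative F (at x) (fst u) * Y y)) (at (x, y))"
  using has_derivative_mult[OF has_derivative_power[OF fst_has_derivative[OF F_differentiable[OF x]]]
      snd_has_derivative[OF Y], of 2] by (simp add: mult_ac)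

text \<open>Closedness is applied to one vector from each factor. One side is
  \<open>2 * F x * dF(u) * G\<^sub>2 y (Z\<^sub>2 y) w\<close>; the other is zero, since pairing
  with \<open>(u, 0)\<close> gives a function of the first coordinate alone.\<close>

lemma warping_derivative_zero:
  assumes "chart_concurrent (S\<^sub>1 \<times> S\<^sub>2) P (\<lambda>z. (Z\<^sub>1 (fst z), Z\<^sub>2 (snd z)))"
    and Z1: "smooth_on S\<^sub>1 Z\<^sub>1" and Z2: "smooth_on S\<^sub>2 Z\<^sub>2" and x: "x \<in> S\<^sub>1" and y: "y \<in> S\<^sub>2" "Z\<^sub>2 y \<noteq> 0"
  shows "frechet_derivative F (at x) u = 0"
proof -
  interpret c: chart_concurrent "S\<^sub>1 \<times> S\<^sub>2" P "\<lambda>z. (Z\<^sub>1 (fst z), Z\<^sub>2 (snd z))" by fact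
  \<comment> \<open>\<open>Z\<^sub>2 y\<close> itself would not do as the test vector, since it may
    be null.\<close>
  obtain w where w: "G\<^sub>2 y (Z\<^sub>2 y) w \<noteq> 0" using m2.G_nondegenerate[OF y(1)] y(2) by blast
  have xy: "(x, y) \<in> S\<^sub>1 \<times> S\<^sub>2" using x y by simp
  let ?\<theta> = "\<lambda>w z. P z (Z\<^sub>1 (fst z), Z\<^sub>2 (snd z)) w"
  have d2: "(\<lambda>y. G\<^sub>2 y (Z\<^sub>2 y) w) differentiable (at y)"
    using smooth_on_imp_differentiable[OF m2.smooth_pairing[OF Z2 smooth_on_const] y(1)] .
  note warped = warped_has_derivative[OF x d2]
  have "(?\<theta> (0, w) has_derivative (\<lambda>u. (F x)\<^sup>2 * frechet_derivative (\<lambda>y. G\<^sub>2 y (Z\<^sub>2 y) w) (at y) (snd u)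
      + 2 * F x * frechet_derivative F (at x) (fst u) * G\<^sub>2 y (Z\<^sub>2 y) w)) (at (x, y))"
    by (rule has_derivative_transform_within_open[OF warped open_product xy])
       (auto simp: P bilinear_rzero[OF m1.G_bilinear])
  from frechet_derivativeI[OF this]
  have "frechet_derivative (?\<theta> (0, w)) (at (x, y)) (u, 0)
      = (F x)\<^sup>2 * frechet_derivative (\<lambda>y. G\<^sub>2 y (Z\<^sub>2 y) w) (at y) 0
        + 2 * F x * frechet_derivative F (at x) u * G\<^sub>2 y (Z\<^sub>2 y) w" by simp
  moreover have "frechet_derivative (?\<theta> (u, 0)) (at (x, y)) (0, w) = 0"
  proof -
    have d: "(\<lambda>x. G\<^sub>1 x (Z\<^sub>1 x) u) differentiable (at x)"
      using smooth_on_imp_differentiable[OF m1.smooth_pairing[OF Z1 smooth_on_const] x] .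
    have "(?\<theta> (u, 0) has_derivative (\<lambda>h. frechet_derivative (\<lambda>x. G\<^sub>1 x (Z\<^sub>1 x) u) (at x) (fst h))) (at (x, y))"
      by (rule has_derivative_transform_within_open[OF fst_has_derivative[OF d] open_product xy])
         (auto simp: P bilinear_rzero[OF m2.G_bilinear])
    from frechet_derivativeI[OF this] show ?thesis
      using linear_0[OF linear_frechet_derivative[OF d]] by simp
  qed
  moreover have "frechet_derivative (\<lambda>y. G\<^sub>2 y (Z\<^sub>2 y) w) (at y) 0 = 0"
    by (intro linear_0 linear_frechet_derivative d2)
  ultimately show ?thesis using w F_pos[OF x] c.dual_form_closed[OF xy, of "(0, w)" "(u, 0)"] by simp
qed

text \<open>By uniqueness the candidate only has to satisfy the defining conditions.
  \<open>F0\<close> removes the sole mixing term, and the remaining factor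
  \<open>(F x)\<^sup>2\<close> is common to both sides of compatibility, so it leaves no trace in
  the connection.\<close>

lemma christoffel_product:
  assumes x: "x \<in> S\<^sub>1" and y: "y \<in> S\<^sub>2" and F0: "\<And>u. frechet_derivative F (at x) u = 0"
  shows "christoffel P (x, y) u v
    = (christoffel G\<^sub>1 x (fst u) (fst v), christoffel G\<^sub>2 y (snd u) (snd v))"
proof -
  let ?\<Gamma> = "\<lambda>u v. (christoffel G\<^sub>1 x (fst u) (fst v), christoffel G\<^sub>2 y (snd u) (snd v))"
  have "levi_civita P (x, y) ?\<Gamma>"
    unfolding levi_civita_def
  proof (intro conjI allI)
    note b1 = m1.christoffel_bilinear[OF x] and b2 = m2.christoffel_bilinear[OF y]
    show "bilinear ?\<Gamma>"
      unfolding bilinear_def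
      by (intro conjI allI linearI)
         (simp_all add: bilinear_ladd[OF b1] bilinear_ladd[OF b2] bilinear_radd[OF b1] bilinear_radd[OF b2]
           bilinear_lmul[OF b1] bilinear_lmul[OF b2] bilinear_rmul[OF b1] bilinear_rmul[OF b2])
    show "?\<Gamma> u v = ?\<Gamma> v u" for u v
      using m1.christoffel_sym[OF x] m2.christoffel_sym[OF y] by simp
    show "frechet_derivative (\<lambda>z. P z v w) (at (x, y)) u = P (x, y) (?\<Gamma> u v) w + P (x, y) v (?\<Gamma> u w)"
      for u v w
      unfolding P
      by (subst frechet_derivativeI[OF has_derivative_add[OF
              fst_has_derivative[OF m1.G_differentiable[OF x]]
              warped_has_derivative[OF x m2.G_differentiable[OF y]]]])
         (simp add: F0 m1.christoffel_metric[OF x] m2.christoffel_metric[OF y] algebra_simps)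
  qed
  from p.christoffelI[OF _ this] x y show ?thesis by simp
qed

lemma cov_product:
  assumes x: "x \<in> S\<^sub>1" and y: "y \<in> S\<^sub>2" and F0: "\<And>u. frechet_derivative F (at x) u = 0"
    and Y: "Y\<^sub>1 differentiable (at x)" "Y\<^sub>2 differentiable (at y)"
  shows "cov P (\<lambda>_. u) (\<lambda>z. (Y\<^sub>1 (fst z), Y\<^sub>2 (snd z))) (x, y)
    = (cov G\<^sub>1 (\<lambda>_. fst u) Y\<^sub>1 x, cov G\<^sub>2 (\<lambda>_. snd u) Y\<^sub>2 y)"
  unfolding cov_def
  by (subst frechet_derivativeI[OF has_derivative_Pair[OF fst_has_derivative[OF Y(1)] snd_has_derivative[OF Y(2)]]])
     (simp add: christoffel_product[OF x y F0])

text \<open>The splitting of the symbols is differentiated here, so it must hold around the point;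
  hence \<open>F0\<close> is required on all of \<open>S\<^sub>1\<close>.\<close>

lemma curvature_product:
  assumes x: "x \<in> S\<^sub>1" and y: "y \<in> S\<^sub>2" and F0: "\<And>x u. x \<in> S\<^sub>1 \<Longrightarrow> frechet_derivative F (at x) u = 0"
  shows "curvature P (\<lambda>_. u) (\<lambda>_. v) (\<lambda>_. w) (x, y)
    = (curvature G\<^sub>1 (\<lambda>_. fst u) (\<lambda>_. fst v) (\<lambda>_. fst w) x,
       curvature G\<^sub>2 (\<lambda>_. snd u) (\<lambda>_. snd v) (\<lambda>_. snd w) y)"
proof -
  have xy: "(x, y) \<in> S\<^sub>1 \<times> S\<^sub>2" using x y by simp
  note ch = christoffel_product[OF _ _ F0]
  have "((\<lambda>z. christoffel P z v w) has_derivative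
      (\<lambda>u. (frechet_derivative (\<lambda>x. christoffel G\<^sub>1 x (fst v) (fst w)) (at x) (fst u),
            frechet_derivative (\<lambda>y. christoffel G\<^sub>2 y (snd v) (snd w)) (at y) (snd u)))) (at (x, y))" for v w
    by (rule has_derivative_transform_within_open[OF has_derivative_Pair[OF
            fst_has_derivative[OF m1.christoffel_differentiable[OF x]]
            snd_has_derivative[OF m2.christoffel_differentiable[OF y]]] open_product xy])
       (auto simp: ch)
  then have "frechet_derivative (\<lambda>z. christoffel P z v w) (at (x, y)) =
      (\<lambda>u. (frechet_derivative (\<lambda>x. christoffel G\<^sub>1 x (fst v) (fst w)) (at x) (fst u),
            frechet_derivative (\<lambda>y. christoffel G\<^sub>2 y (snd v) (snd w)) (at y) (snd u)))" for v w
    by (rule frechet_derivativeI)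
  then show ?thesis
    by (simp add: p.curvature_const[OF xy] m1.curvature_const[OF x] m2.curvature_const[OF y] ch x y)
qed

text \<open>The basis of the product is the disjoint union of the two embedded bases, so the trace
  of the block diagonal curvature is the sum of the traces.\<close>

lemma ricci_product:
  assumes x: "x \<in> S\<^sub>1" and y: "y \<in> S\<^sub>2" and F0: "\<And>x u. x \<in> S\<^sub>1 \<Longrightarrow> frechet_derivative F (at x) u = 0"
  shows "ricci P (x, y) v w = ricci G\<^sub>1 x (fst v) (fst w) + ricci G\<^sub>2 y (snd v) (snd w)"
proof -
  have "ricci P (x, y) v w = (\<Sum>b\<in>(\<lambda>b. (b, 0)) ` Basis \<union> (\<lambda>b. (0, b)) ` Basis.
      curvature P (\<lambda>_. b) (\<lambda>_. v) (\<lambda>_. w) (x, y) \<bullet> b)"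
    by (simp add: ricci_def Basis_prod_def)
  also have "\<dots> = ricci G\<^sub>1 x (fst v) (fst w) + ricci G\<^sub>2 y (snd v) (snd w)"
    by (subst sum.union_disjoint)
       (auto simp: sum.reindex inj_on_def ricci_def curvature_product[OF x y F0])
  finally show ?thesis .
qed

end
theorem theorem4:
  fixes M\<^sub>1 :: "('i, 'a::{t2_space,second_countable_topology}, 'd::euclidean_space) atlas"
    and M\<^sub>2 :: "('j, 'b::{t2_space,second_countable_topology}, 'e::euclidean_space) atlas"
    and g\<^sub>1 :: "('i, 'd) tensor2" and g\<^sub>2 :: "('j, 'e) tensor2"
    and \<zeta>\<^sub>1 :: "('i, 'd) vfield" and \<zeta>\<^sub>2 :: "('j, 'e) vfield"
    and f :: "'a \<Rightarrow> real" and lam :: real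
    and M :: "('i \<times> 'j, 'a \<times> 'b, 'd \<times> 'e) atlas"
    and g :: "('i \<times> 'j, 'd \<times> 'e) tensor2" and \<zeta> :: "('i \<times> 'j, 'd \<times> 'e) vfield"
  assumes "M = product_atlas M\<^sub>1 M\<^sub>2"
    and "g = warped_metric M\<^sub>1 f g\<^sub>1 g\<^sub>2"
    and "\<zeta> = vf_add (lift\<^sub>1 \<zeta>\<^sub>1) (lift\<^sub>2 \<zeta>\<^sub>2)"
    and "pseudo_riemannian_manifold M\<^sub>1 g\<^sub>1"
    and "pseudo_riemannian_manifold M\<^sub>2 g\<^sub>2"
    and "smooth_function M\<^sub>1 f" and "\<forall>p\<in>points M\<^sub>1. f p > 0"
    and "vector_field M\<^sub>1 \<zeta>\<^sub>1" and "vector_field M\<^sub>2 \<zeta>\<^sub>2"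
    and "ricci_soliton M g \<zeta> lam"
    and "concurrent M g \<zeta>"
    and "vf_nonzero M\<^sub>2 \<zeta>\<^sub>2"
  shows "lam = 1 \<and>
    ricci_flat M g \<and> ricci_flat M\<^sub>1 g\<^sub>1 \<and> ricci_flat M\<^sub>2 g\<^sub>2 \<and>
    gradient_ricci_soliton M g \<zeta> 1 \<and>
    gradient_ricci_soliton M\<^sub>1 g\<^sub>1 \<zeta>\<^sub>1 1 \<and>
    gradient_ricci_soliton M\<^sub>2 g\<^sub>2 \<zeta>\<^sub>2 1"
proof -
  note M = assms(1) and g = assms(2) and \<zeta> = assms(3)
  note pr1 = assms(4) and pr2 = assms(5) and vf1 = assms(8) and vf2 = assms(9)
  have pr: "pseudo_riemannian_manifold M g" and vf: "vector_field M \<zeta>"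
    and sol: "\<And>k z u v. k \<in> charts M \<Longrightarrow> z \<in> region M k \<Longrightarrow>
      1 / 2 * lie_metric (\<zeta> k) (g k) z u v + ricci (g k) z u v = lam * g k z u v"
    using assms(10) unfolding ricci_soliton_def by blast+
  interpret a1: smooth_atlas M\<^sub>1
    using pr1 by unfold_locales (simp add: pseudo_riemannian_manifold_def)
  have charts: "k \<in> charts M \<longleftrightarrow> fst k \<in> charts M\<^sub>1 \<and> snd k \<in> charts M\<^sub>2" for k
    by (simp add: M product_atlas_def mem_Times_iff)
  have region: "region M (i, j) = region M\<^sub>1 i \<times> region M\<^sub>2 j" for i j
    by (force simp: M product_atlas_def region_def)
  have \<zeta>_chart: "\<zeta> (i, j) = (\<lambda>z. (\<zeta>\<^sub>1 i (fst z), \<zeta>\<^sub>2 j (snd z)))" for i j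
    by (simp add: \<zeta> vf_add_def lift\<^sub>1_def lift\<^sub>2_def)
  note cc = concurrent_chart_concurrent[OF pr assms(11)]
  have warped: "chart_warped (region M\<^sub>1 i) (g\<^sub>1 i) (region M\<^sub>2 j) (g\<^sub>2 j) (g (i, j)) (f \<circ> coord_inv M\<^sub>1 i)"
    if i: "i \<in> charts M\<^sub>1" and j: "j \<in> charts M\<^sub>2" for i j
  proof -
    interpret m1: chart_metric "region M\<^sub>1 i" "g\<^sub>1 i" by (rule pseudo_riemannian_chart_metric[OF pr1 i])
    interpret m2: chart_metric "region M\<^sub>2 j" "g\<^sub>2 j" by (rule pseudo_riemannian_chart_metric[OF pr2 j])
    interpret p: chart_metric "region M\<^sub>1 i \<times> region M\<^sub>2 j" "g (i, j)"
      using pseudo_riemannian_chart_metric[OF pr, of "(i, j)"] i j by (simp add: charts region)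
    show ?thesis
    proof
      show "0 < (f \<circ> coord_inv M\<^sub>1 i) x" if "x \<in> region M\<^sub>1 i" for x
        using assms(7) a1.coord_inv_in[OF i that] i by (auto simp: points_def)
      show "(f \<circ> coord_inv M\<^sub>1 i) differentiable (at x)" if "x \<in> region M\<^sub>1 i" for x
        using assms(6) i that smooth_on_imp_differentiable unfolding smooth_function_def by blast
    qed (simp add: g warped_metric_def)
  qed
  have sm1: "smooth_on (region M\<^sub>1 i) (\<zeta>\<^sub>1 i)" if "i \<in> charts M\<^sub>1" for i
    using vf1 that unfolding vector_field_def by blast
  have sm2: "smooth_on (region M\<^sub>2 j) (\<zeta>\<^sub>2 j)" if "j \<in> charts M\<^sub>2" for j
    using vf2 that unfolding vector_field_def by blast
  obtain j\<^sub>0 y\<^sub>0 where j0: "j\<^sub>0 \<in> charts M\<^sub>2" and y0: "y\<^sub>0 \<in> region M\<^sub>2 j\<^sub>0" "\<zeta>\<^sub>2 j\<^sub>0 y\<^sub>0 \<noteq> 0"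
    using assms(12) unfolding vf_nonzero_def by blast
  obtain i\<^sub>0 x\<^sub>0 where i0: "i\<^sub>0 \<in> charts M\<^sub>1" and x0: "x\<^sub>0 \<in> region M\<^sub>1 i\<^sub>0"
    using a1.smooth a1.coord_in unfolding smooth_manifold_def points_def by blast
  \<comment> \<open>The point \<open>y\<^sub>0\<close> in chart \<open>j\<^sub>0\<close> stays fixed
    while the chart and the point of the first factor are arbitrary, so one nonzero value of
    \<open>\<zeta>\<^sub>2\<close> controls \<open>df\<close> everywhere.\<close>
  have df: "frechet_derivative (f \<circ> coord_inv M\<^sub>1 i) (at x) u = 0"
    if i: "i \<in> charts M\<^sub>1" and x: "x \<in> region M\<^sub>1 i" for i x u
  proof -
    interpret chart_warped "region M\<^sub>1 i" "g\<^sub>1 i" "region M\<^sub>2 j\<^sub>0" "g\<^sub>2 j\<^sub>0" "g (i, j\<^sub>0)" "f \<circ> coord_inv M\<^sub>1 i"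
      by (rule warped[OF i j0])
    show ?thesis
      using warping_derivative_zero[OF _ sm1[OF i] sm2[OF j0] x y0] cc[of "(i, j\<^sub>0)"] i j0
      by (simp add: charts region \<zeta>_chart)
  qed
  have cov: "cov (g (i, j)) (\<lambda>_. u) (\<zeta> (i, j)) (x, y)
      = (cov (g\<^sub>1 i) (\<lambda>_. fst u) (\<zeta>\<^sub>1 i) x, cov (g\<^sub>2 j) (\<lambda>_. snd u) (\<zeta>\<^sub>2 j) y)"
    and ric: "ricci (g (i, j)) (x, y) v w
      = ricci (g\<^sub>1 i) x (fst v) (fst w) + ricci (g\<^sub>2 j) y (snd v) (snd w)"
    if i: "i \<in> charts M\<^sub>1" and x: "x \<in> region M\<^sub>1 i" and j: "j \<in> charts M\<^sub>2" and y: "y \<in> region M\<^sub>2 j"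
    for i j x y u v w
  proof -
    interpret chart_warped "region M\<^sub>1 i" "g\<^sub>1 i" "region M\<^sub>2 j" "g\<^sub>2 j" "g (i, j)" "f \<circ> coord_inv M\<^sub>1 i"
      by (rule warped[OF i j])
    show "cov (g (i, j)) (\<lambda>_. u) (\<zeta> (i, j)) (x, y)
        = (cov (g\<^sub>1 i) (\<lambda>_. fst u) (\<zeta>\<^sub>1 i) x, cov (g\<^sub>2 j) (\<lambda>_. snd u) (\<zeta>\<^sub>2 j) y)"
      unfolding \<zeta>_chart
      by (rule cov_product[OF x y df[OF i x] smooth_on_imp_differentiable[OF sm1[OF i] x]
            smooth_on_imp_differentiable[OF sm2[OF j] y]])
    show "ricci (g (i, j)) (x, y) v w
        = ricci (g\<^sub>1 i) x (fst v) (fst w) + ricci (g\<^sub>2 j) y (snd v) (snd w)"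
      by (rule ricci_product[OF x y df[OF i]])
  qed
  have cov_\<zeta>: "cov (g (i, j)) (\<lambda>_. u) (\<zeta> (i, j)) (x, y) = u"
    if "i \<in> charts M\<^sub>1" "x \<in> region M\<^sub>1 i" "j \<in> charts M\<^sub>2" "y \<in> region M\<^sub>2 j" for i j x y u
    using chart_concurrent.cov_Z[OF cc[of "(i, j)"]] that by (simp add: charts region)
  have cc1: "chart_concurrent (region M\<^sub>1 i) (g\<^sub>1 i) (\<zeta>\<^sub>1 i)" if i: "i \<in> charts M\<^sub>1" for i
  proof -
    interpret chart_metric "region M\<^sub>1 i" "g\<^sub>1 i" by (rule pseudo_riemannian_chart_metric[OF pr1 i])
    show ?thesis
      \<comment> \<open>The base point of the second factor only completes a point of the product;
        the vectors \<open>(u, 0)\<close> isolate the first component of the split covariant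
        derivative.\<close>
      using cov[OF i _ j0 y0(1), of _ "(u, 0)" for u] cov_\<zeta>[OF i _ j0 y0(1), of _ "(u, 0)" for u] sm1[OF i]
      by unfold_locales auto
  qed
  have cc2: "chart_concurrent (region M\<^sub>2 j) (g\<^sub>2 j) (\<zeta>\<^sub>2 j)" if j: "j \<in> charts M\<^sub>2" for j
  proof -
    interpret chart_metric "region M\<^sub>2 j" "g\<^sub>2 j" by (rule pseudo_riemannian_chart_metric[OF pr2 j])
    show ?thesis
      using cov[OF i0 x0 j, of _ "(0, u)" for u] cov_\<zeta>[OF i0 x0 j, of _ "(0, u)" for u] sm2[OF j]
      by unfold_locales auto
  qed
  have "lam = 1"
  proof -
    let ?k = "(i\<^sub>0, j\<^sub>0)" and ?z = "(x\<^sub>0, y\<^sub>0)"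
    have k: "?k \<in> charts M" and z: "?z \<in> region M ?k" using i0 j0 x0 y0 by (simp_all add: charts region)
    interpret chart_concurrent "region M ?k" "g ?k" "\<zeta> ?k" by (rule cc[OF k])
    have "\<zeta> ?k ?z \<noteq> 0" using y0 by (simp add: \<zeta>_chart zero_prod_def)
    \<comment> \<open>Nondegeneracy gives a \<open>v\<close> whose pairing with
      \<open>\<zeta>\<close> can be cancelled; \<open>\<zeta>\<close> paired with itself might be
      zero.\<close>
    then obtain v where "g ?k ?z (\<zeta> ?k ?z) v \<noteq> 0" using G_nondegenerate[OF z] by blast
    then have "g ?k ?z v (\<zeta> ?k ?z) \<noteq> 0" by (simp add: G_sym[OF z, of v])
    then show ?thesis
      using sol[OF k z, of v "\<zeta> ?k ?z"] by (simp add: lie_metric_Z[OF z] ricci_Z[OF z])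
  qed
  moreover have flat: "ricci_flat M g"
    unfolding ricci_flat_def
  proof (intro ballI allI)
    fix k z u v assume k: "k \<in> charts M" and z: "z \<in> region M k"
    show "ricci (g k) z u v = 0"
      using sol[OF k z, of u v] \<open>lam = 1\<close> by (simp add: chart_concurrent.lie_metric_Z[OF cc[OF k] z])
  qed
  moreover have flat1: "ricci_flat M\<^sub>1 g\<^sub>1"
    unfolding ricci_flat_def
  proof (intro ballI allI)
    fix i x u v assume i: "i \<in> charts M\<^sub>1" and x: "x \<in> region M\<^sub>1 i"
    \<comment> \<open>The slot \<open>\<zeta>\<^sub>2 j\<^sub>0 y\<^sub>0\<close> is chosen so that
      \<open>ricci_Z\<close> kills the contribution of the second factor, without any appeal to
      linearity of \<open>ricci\<close>.\<close>
    have "ricci (g (i, j\<^sub>0)) (x, y\<^sub>0) (u, 0) (v, \<zeta>\<^sub>2 j\<^sub>0 y\<^sub>0) = 0"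
      using flat i x j0 y0 by (simp add: ricci_flat_def charts region)
    then show "ricci (g\<^sub>1 i) x u v = 0"
      by (simp add: ric[OF i x j0 y0(1)] chart_concurrent.ricci_Z[OF cc2[OF j0] y0(1)])
  qed
  moreover have flat2: "ricci_flat M\<^sub>2 g\<^sub>2"
    unfolding ricci_flat_def
  proof (intro ballI allI)
    fix j y u v assume j: "j \<in> charts M\<^sub>2" and y: "y \<in> region M\<^sub>2 j"
    \<comment> \<open>Here \<open>\<zeta>\<^sub>1 i\<^sub>0 x\<^sub>0\<close> plays the
      corresponding part; it may be zero, which does no harm to \<open>ricci_Z\<close>.\<close>
    have "ricci (g (i\<^sub>0, j)) (x\<^sub>0, y) (0, u) (\<zeta>\<^sub>1 i\<^sub>0 x\<^sub>0, v) = 0"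
      using flat i0 x0 j y by (simp add: ricci_flat_def charts region)
    then show "ricci (g\<^sub>2 j) y u v = 0"
      by (simp add: ric[OF i0 x0 j y] chart_concurrent.ricci_Z[OF cc1[OF i0] x0])
  qed
  ultimately show ?thesis
    using gradient_ricci_soliton_concurrent[OF pr vf cc flat]
      gradient_ricci_soliton_concurrent[OF pr1 vf1 cc1 flat1]
      gradient_ricci_soliton_concurrent[OF pr2 vf2 cc2 flat2] by blast
qed

end
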